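(* Suppose $\mathcal{A}$ is a separable unital matricially tracially stable $C^*$-algebra with at least one embeddable tracial state. Then: (1) For all but finitely many positive integers $n$ there is a unital representation $\pi_n:\mathcal{A}\to\mathcal{M}_n(\mathbb{C})$. (2) The set of embeddable tracial states on $\mathcal{A}$ is the weak$^*$-closed convex hull of the set of matricial tracial states on $\mathcal{A}$.
   Context: $\tau_n$ is the normalized trace on $\mathcal{M}_n(\mathbb{C})$. If $\rho$ is a tracial state on a unital $C^*$-algebra, put $\|x\|_{2,\rho}=\rho(x^*x)^{1/2}$. An ultrafilter $\alpha$ on an infinite set $I$ is nontrivial if there is a sequence $\{E_n\}$ in $\alpha$ with $\bigcap_n E_n=\varnothing$. Given unital $C^*$-algebras $\mathcal{A}_i$ with tracial states $\rho_i$ ($i\in I$), the tracial ultraproduct $\prod_{i\in I}^{\alpha}(\mathcal{A}_i,\rho_i)$ is the $C^*$-product $\prod_{i\in I}\mathcal{A}_i$ (bounded families) modulo the ideal of all $\{a_i\}$ with $\lim_{i\to\alpha}\|a_i\|_{2,\rho_i}=0$; the coset of $\{a_i\}$ is denoted $\{a_i\}_\alpha$, and the limit trace is $\rho_\alpha(\{a_i\}_\alpha)=\lim_{i\to\alpha}\rho_i(a_i)$. A unital $*$-homomorphism $\pi:\mathcal{A}\to\prod_{i\in I}^{\alpha}(\mathcal{A}_i,\rho_i)$ is approximately liftable if there are $E\in\alpha$ and, for every $i\in E$, a unital $*$-homomorphism $\pi_i:\mathcal{A}\to\mathcal{A}_i$ such that $\pi(a)=\{\pi_i(a)\}_\alpha$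 for every $a\in\mathcal{A}$ (where $\pi_i(a)=0$ for $i\notin E$). A separable unital $\mathcal{A}$ is matricially tracially stable if every unital $*$-homomorphism from $\mathcal{A}$ into any tracial ultraproduct of full matrix algebras (over any nontrivial ultrafilter) is approximately liftable. A tracial state $\tau$ on $\mathcal{A}$ is embeddable if there are a nontrivial ultrafilter $\alpha$ on $\mathbb{N}$ and a unital $*$-homomorphism $\pi:\mathcal{A}\to\prod_{n\in\mathbb{N}}^{\alpha}(\mathcal{M}_n(\mathbb{C}),\tau_n)$ with $\tau_\alpha\circ\pi=\tau$. A tracial state $\tau$ is matricial if there are a positive integer $n$ and a unital $*$-homomorphism $\pi:\mathcal{A}\to\mathcal{M}_n(\mathbb{C})$ with $\tau=\tau_n\circ\pi$. *)

theory Defs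
  imports
    "HOL-Library.Function_Algebras"
    "HOL-Analysis.Convex"
    "HOL-Analysis.Function_Topology"
    "HOL-Analysis.Abstract_Topological_Spaces"
    "HOL-Algebra.Module"
    "HOL-Algebra.QuotRing"
    "Jordan_Normal_Form.Schur_Decomposition"
begin

section \<open>Unital C*-algebras\<close>

text \<open>
  The algebra whose traces are studied is a type of this class. The axiom
  \<open>norm 1 = 1\<close> inherited from \<open>real_normed_algebra_1\<close> only rules out the zero
  algebra, which has no state.
\<close>

class unital_cstar_algebra = real_normed_algebra_1 + banach +
  fixes scaleC :: "complex \<Rightarrow> 'a \<Rightarrow> 'a"
    and star :: "'a \<Rightarrow> 'a"
  assumes scaleC_add_right: "scaleC c (x + y) = scaleC c x + scaleC c y"
    and scaleC_add_left: "scaleC (c + d) x = scaleC c x + scaleC d x"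
    and scaleC_scaleC: "scaleC c (scaleC d x) = scaleC (c * d) x"
    and scaleC_of_real: "scaleC (complex_of_real r) x = r *\<^sub>R x"
    and mult_scaleC_left: "scaleC c x * y = scaleC c (x * y)"
    and mult_scaleC_right: "x * scaleC c y = scaleC c (x * y)"
    and norm_scaleC: "norm (scaleC c x) = cmod c * norm x"
    and star_add: "star (x + y) = star x + star y"
    and star_scaleC: "star (scaleC c x) = scaleC (cnj c) (star x)"
    and star_mult: "star (x * y) = star y * star x"
    and star_star: "star (star x) = x"
    and cstar_identity: "norm (star x * x) = (norm x)\<^sup>2"

text \<open>Boundedness of \<open>\<tau>\<close> is automatic, since \<open>\<tau>\<close> is positive.\<close>

definition tracial_state :: "('a::unital_cstar_algebra \<Rightarrow> complex) \<Rightarrow> bool" where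
  "tracial_state \<tau> \<longleftrightarrow>
     (\<forall>x y. \<tau> (x + y) = \<tau> x + \<tau> y) \<and>
     (\<forall>c x. \<tau> (scaleC c x) = c * \<tau> x) \<and>
     (\<forall>x. \<tau> (star x * x) \<in> \<real> \<and> 0 \<le> Re (\<tau> (star x * x))) \<and>
     \<tau> 1 = 1 \<and>
     (\<forall>x y. \<tau> (x * y) = \<tau> (y * x))"

text \<open>
  Pointwise scalar multiplication makes \<open>'a \<Rightarrow> complex\<close> a real vector space; its
  topology from \<open>Function_Topology\<close> is that of pointwise convergence. On sets of
  states the latter is the weak* topology, and pointwise limits of tracial states are
  tracial states, so closures may be taken in the whole function space.
\<close>

instantiation "fun" :: (type, scaleR) scaleR
begin

definition scaleR_fun_def: "scaleR r f = (\<lambda>x. r *\<^sub>R f x)"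

instance ..

end

instance "fun" :: (type, real_vector) real_vector
  by standard (auto simp: scaleR_fun_def fun_eq_iff scaleR_add_right scaleR_add_left)


section \<open>Concrete *-algebras with a norm\<close>

text \<open>
  Matrix algebras and ultraproducts depend on parameters and so are given with explicit
  carriers, as extensions of the records of \<open>HOL-Algebra\<close>.
\<close>

record 'b normed_star_algebra = "(complex, 'b) module" +
  adj :: "'b \<Rightarrow> 'b"
  nrm :: "'b \<Rightarrow> real"

definition unital_star_hom ::
  "('a::unital_cstar_algebra \<Rightarrow> 'b) \<Rightarrow> 'b normed_star_algebra \<Rightarrow> bool" where
  "unital_star_hom \<pi> B \<longleftrightarrow>
     (\<forall>x. \<pi> x \<in> carrier B) \<and>
     (\<forall>x y. \<pi> (x + y) = \<pi> x \<oplus>\<^bsub>B\<^esub> \<pi> y) \<and>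
     (\<forall>c x. \<pi> (scaleC c x) = c \<odot>\<^bsub>B\<^esub> \<pi> x) \<and>
     (\<forall>x y. \<pi> (x * y) = \<pi> x \<otimes>\<^bsub>B\<^esub> \<pi> y) \<and>
     (\<forall>x. \<pi> (star x) = adj B (\<pi> x)) \<and>
     \<pi> 1 = \<one>\<^bsub>B\<^esub>"


section \<open>Full matrix algebras\<close>

definition l2_norm_vec :: "complex vec \<Rightarrow> real" where
  "l2_norm_vec v = sqrt (\<Sum>i<dim_vec v. (cmod (v $ i))\<^sup>2)"

definition matrix_op_norm :: "nat \<Rightarrow> complex mat \<Rightarrow> real" where
  "matrix_op_norm n X =
     Sup {l2_norm_vec (X *\<^sub>v v) | v. v \<in> carrier_vec n \<and> l2_norm_vec v \<le> 1}"

definition matrix_algebra :: "nat \<Rightarrow> complex mat normed_star_algebra" where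
  "matrix_algebra n =
     \<lparr>carrier = carrier_mat n n, monoid.mult = (*), one = 1\<^sub>m n, zero = 0\<^sub>m n n, add = (+),
      module.smult = (\<cdot>\<^sub>m), adj = mat_adjoint, nrm = matrix_op_norm n\<rparr>"

definition normalized_trace :: "nat \<Rightarrow> complex mat \<Rightarrow> complex" where
  "normalized_trace n X = (\<Sum>i<n. X $$ (i, i)) / of_nat n"


section \<open>Tracial ultraproducts\<close>

text \<open>
  An ultrafilter on a set \<open>I\<close> is encoded as a filter on the ambient type; a set
  \<open>E\<close> belongs to it iff \<open>\<forall>\<^sub>F i in \<alpha>. i \<in> E\<close>.
\<close>

definition ultrafilter_on :: "'i set \<Rightarrow> 'i filter \<Rightarrow> bool" where
  "ultrafilter_on I \<alpha> \<longleftrightarrow>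
     \<alpha> \<noteq> bot \<and> (\<forall>\<^sub>F i in \<alpha>. i \<in> I) \<and>
     (\<forall>E. (\<forall>\<^sub>F i in \<alpha>. i \<in> E) \<or> (\<forall>\<^sub>F i in \<alpha>. i \<notin> E))"

definition nontrivial_ultrafilter_on :: "'i set \<Rightarrow> 'i filter \<Rightarrow> bool" where
  "nontrivial_ultrafilter_on I \<alpha> \<longleftrightarrow>
     infinite I \<and> ultrafilter_on I \<alpha> \<and>
     (\<exists>E :: nat \<Rightarrow> 'i set.
        (\<forall>n. E n \<subseteq> I \<and> (\<forall>\<^sub>F i in \<alpha>. i \<in> E n)) \<and> (\<Inter>n. E n) = {})"

definition cstar_product ::
  "'i set \<Rightarrow> ('i \<Rightarrow> 'b normed_star_algebra) \<Rightarrow> ('i \<Rightarrow> 'b) normed_star_algebra" where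
  "cstar_product I A =
     \<lparr>carrier = {a \<in> (\<Pi>\<^sub>E i\<in>I. carrier (A i)). \<exists>C. \<forall>i\<in>I. nrm (A i) (a i) \<le> C},
      monoid.mult = (\<lambda>a b. \<lambda>i\<in>I. a i \<otimes>\<^bsub>A i\<^esub> b i),
      one = (\<lambda>i\<in>I. \<one>\<^bsub>A i\<^esub>),
      zero = (\<lambda>i\<in>I. \<zero>\<^bsub>A i\<^esub>),
      add = (\<lambda>a b. \<lambda>i\<in>I. a i \<oplus>\<^bsub>A i\<^esub> b i),
      module.smult = (\<lambda>c a. \<lambda>i\<in>I. c \<odot>\<^bsub>A i\<^esub> a i),
      adj = (\<lambda>a. \<lambda>i\<in>I. adj (A i) (a i)),
      nrm = (\<lambda>a. SUP i\<in>I. nrm (A i) (a i))\<rparr>"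

definition trace_2norm :: "'b normed_star_algebra \<Rightarrow> ('b \<Rightarrow> complex) \<Rightarrow> 'b \<Rightarrow> real" where
  "trace_2norm B \<rho> x = sqrt (Re (\<rho> (adj B x \<otimes>\<^bsub>B\<^esub> x)))"

definition trace_null_ideal ::
  "'i set \<Rightarrow> 'i filter \<Rightarrow> ('i \<Rightarrow> 'b normed_star_algebra) \<Rightarrow> ('i \<Rightarrow> 'b \<Rightarrow> complex) \<Rightarrow> ('i \<Rightarrow> 'b) set"
  where
  "trace_null_ideal I \<alpha> A \<rho> =
     {a \<in> carrier (cstar_product I A). ((\<lambda>i. trace_2norm (A i) (\<rho> i) (a i)) \<longlongrightarrow> 0) \<alpha>}"

definition ultraproduct_coset ::
  "'i set \<Rightarrow> 'i filter \<Rightarrow> ('i \<Rightarrow> 'b normed_star_algebra) \<Rightarrow> ('i \<Rightarrow> 'b \<Rightarrow> complex) \<Rightarrow>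
     ('i \<Rightarrow> 'b) \<Rightarrow> ('i \<Rightarrow> 'b) set" where
  "ultraproduct_coset I \<alpha> A \<rho> a = trace_null_ideal I \<alpha> A \<rho> +>\<^bsub>cstar_product I A\<^esub> a"

text \<open>
  The quotient \<open>*\<close>-algebra: its ring structure is that of \<open>FactRing\<close>, the remaining
  operations are induced on cosets in the same way, and \<open>nrm\<close> is the quotient norm.
\<close>

definition tracial_ultraproduct ::
  "'i set \<Rightarrow> 'i filter \<Rightarrow> ('i \<Rightarrow> 'b normed_star_algebra) \<Rightarrow> ('i \<Rightarrow> 'b \<Rightarrow> complex) \<Rightarrow>
     ('i \<Rightarrow> 'b) set normed_star_algebra" where
  "tracial_ultraproduct I \<alpha> A \<rho> =
     (let P = cstar_product I A; Q = P Quot trace_null_ideal I \<alpha> A \<rho>;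
          coset = ultraproduct_coset I \<alpha> A \<rho>
      in \<lparr>carrier = carrier Q, monoid.mult = monoid.mult Q, one = one Q, zero = zero Q, add = add Q,
          module.smult = (\<lambda>c X. \<Union>a\<in>X. coset (c \<odot>\<^bsub>P\<^esub> a)),
          adj = (\<lambda>X. \<Union>a\<in>X. coset (adj P a)),
          nrm = (\<lambda>X. INF a\<in>X. nrm P a)\<rparr>)"

definition limit_trace ::
  "'i filter \<Rightarrow> ('i \<Rightarrow> 'b \<Rightarrow> complex) \<Rightarrow> ('i \<Rightarrow> 'b) set \<Rightarrow> complex" where
  "limit_trace \<alpha> \<rho> X = (THE l. \<exists>a\<in>X. ((\<lambda>i. \<rho> i (a i)) \<longlongrightarrow> l) \<alpha>)"


section \<open>Matricial tracial stability\<close>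

definition approximately_liftable ::
  "'i set \<Rightarrow> 'i filter \<Rightarrow> ('i \<Rightarrow> 'b normed_star_algebra) \<Rightarrow> ('i \<Rightarrow> 'b \<Rightarrow> complex) \<Rightarrow>
     ('a::unital_cstar_algebra \<Rightarrow> ('i \<Rightarrow> 'b) set) \<Rightarrow> bool" where
  "approximately_liftable I \<alpha> A \<rho> \<pi> \<longleftrightarrow>
     (\<exists>E \<phi>. E \<subseteq> I \<and> (\<forall>\<^sub>F i in \<alpha>. i \<in> E) \<and>
        (\<forall>i\<in>E. unital_star_hom (\<phi> i) (A i)) \<and>
        (\<forall>a. \<pi> a = ultraproduct_coset I \<alpha> A \<rho> (\<lambda>i\<in>I. if i \<in> E then \<phi> i a else \<zero>\<^bsub>A i\<^esub>)))"

text \<open>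
  HOL cannot quantify over types inside a definition, so the type in which the index sets
  live is a parameter; it should be infinite, since otherwise there are no nontrivial
  ultrafilters and the condition is void.
\<close>

definition matricially_tracially_stable ::
  "'a::unital_cstar_algebra itself \<Rightarrow> 'i itself \<Rightarrow> bool" where
  "matricially_tracially_stable _ _ \<longleftrightarrow>
     (\<forall>(I :: 'i set) \<alpha> (k :: 'i \<Rightarrow> nat)
       (\<pi> :: 'a \<Rightarrow> ('i \<Rightarrow> complex mat) set).
        nontrivial_ultrafilter_on I \<alpha> \<longrightarrow> (\<forall>i\<in>I. 0 < k i) \<longrightarrow>
        unital_star_hom \<pi>
          (tracial_ultraproduct I \<alpha> (\<lambda>i. matrix_algebra (k i)) (\<lambda>i. normalized_trace (k i))) \<longrightarrow>
        approximately_liftable I \<alpha> (\<lambda>i. matrix_algebra (k i)) (\<lambda>i. normalized_trace (k i)) \<pi>)"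

definition embeddable_tracial_state :: "('a::unital_cstar_algebra \<Rightarrow> complex) \<Rightarrow> bool" where
  "embeddable_tracial_state \<tau> \<longleftrightarrow> tracial_state \<tau> \<and>
     (\<exists>\<alpha> (\<pi> :: 'a \<Rightarrow> (nat \<Rightarrow> complex mat) set).
        nontrivial_ultrafilter_on {1..} \<alpha> \<and>
        unital_star_hom \<pi> (tracial_ultraproduct {1..} \<alpha> matrix_algebra normalized_trace) \<and>
        (\<forall>a. limit_trace \<alpha> normalized_trace (\<pi> a) = \<tau> a))"

definition matricial_tracial_state :: "('a::unital_cstar_algebra \<Rightarrow> complex) \<Rightarrow> bool" where
  "matricial_tracial_state \<tau> \<longleftrightarrow> tracial_state \<tau> \<and>
     (\<exists>n>0. \<exists>\<pi> :: 'a \<Rightarrow> complex mat.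
        unital_star_hom \<pi> (matrix_algebra n) \<and> \<tau> = normalized_trace n \<circ> \<pi>)"

end

theory Submission
  imports Defs
begin

text \<open>
  Block sums make finite-dimensional representations flexible. A representation on \<open>m\<close>
  dimensions, repeated \<open>n div m\<close> times and completed by a zero block of size \<open>n mod m\<close>, is a
  possibly nonunital representation on \<open>n\<close> dimensions. The zero block takes up less than the
  fraction \<open>m / n\<close> of the dimensions, so it disappears in a tracial ultraproduct when \<open>n\<close> grows: the family
  becomes a unital homomorphism, with the limit trace equal to the trace of the representation
  that was repeated (\<open>padded_representations\<close>, \<open>approximate_star_hom_star_reps\<close>).
  Nonunital representations \<open>\<phi>\<close> are therefore admitted throughout, and \<open>\<phi> 1\<close> is controlled by
  its trace alone, because it is a projection (\<open>star_rep_unit_defect\<close>).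

  An embeddable trace gives, by stability, honest unital representations \<open>\<phi>\<^sub>n\<close> on \<open>n\<close> dimensions
  for the \<open>n\<close> in a set of the ultrafilter, whose traces converge to it
  (\<open>embeddable_tracial_state_limit\<close>). In particular there is one finite-dimensional
  representation. If infinitely many dimensions had none, padding that single representation
  along these dimensions and lifting the resulting homomorphism would produce a representation
  in one of them (\<open>finitely_many_missing_dimensions\<close>).

  The same convergence puts every embeddable trace into the closure of the matricial ones.
  Conversely, block sums with multiplicities realize rational convex combinations, so that the
  closure of the set of matricial traces is already convex (\<open>convex_closure_matricial\<close>). A trace
  in it is, by separability, the limit of a sequence of matricial traces. Padding the
  \<open>k\<close>-th representation of the sequence in the dimensions \<open>n\<close> with \<open>k = k(n)\<close> growing slowly
  yields a homomorphism into the ultraproduct of the \<open>n\<close> by \<open>n\<close> matrices over any free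
  ultrafilter which induces the limit (\<open>closure_matricial_embeddable\<close>).

  Both directions use that representations into matrices are contractive, which makes every
  family of representations a bounded family. The reason is that \<open>r - star a * a\<close> is the square
  of a self-adjoint element for \<open>r > norm (star a * a)\<close>, and representations map such squares to
  positive matrices (\<open>star_rep_op_bound\<close>).
\<close>

section \<open>Positivity in a C*-algebra\<close>

lemma star_zero [simp]: "star (0::'a::unital_cstar_algebra) = 0"
  by (metis add_cancel_right_right star_add)

lemma star_minus: "star (- x) = - star (x::'a::unital_cstar_algebra)"
  by (metis add.right_inverse add_eq_0_iff star_add star_zero)

lemma star_diff: "star (x - y) = star x - star (y::'a::unital_cstar_algebra)"
  using star_add[of x "- y"] by (simp add: star_minus)

lemma star_scaleR: "star (r *\<^sub>R x) = r *\<^sub>R star (x::'a::unital_cstar_algebra)"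
  by (metis complex_cnj_complex_of_real scaleC_of_real star_scaleC)

lemma star_one [simp]: "star (1::'a::unital_cstar_algebra) = 1"
  by (metis mult.right_neutral mult_1 star_mult star_star)

lemma norm_star [simp]: "norm (star x) = norm (x::'a::unital_cstar_algebra)"
proof -
  have le: "norm y \<le> norm (star y)" for y :: 'a
  proof (cases "y = 0")
    case False
    have "norm y * norm y \<le> norm (star y) * norm y"
      using norm_mult_ineq[of "star y" y] by (simp add: cstar_identity power2_eq_square)
    then show ?thesis using False by simp
  qed auto
  show ?thesis using le[of x] le[of "star x"] by (simp add: star_star)
qed

lemma continuous_star: "continuous_on S (star :: 'a::unital_cstar_algebra \<Rightarrow> 'a)"
proof (rule continuous_onI)
  fix x e assume "0 < (e::real)"
  then show "\<exists>d>0. \<forall>x'\<in>S. dist x' x < d \<longrightarrow> dist (star x') (star (x::'a)) \<le> e"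
    by (intro exI[of _ e]) (auto simp: dist_norm star_diff[symmetric])
qed

text \<open>
  Writing the square root as \<open>1 - y\<close> turns \<open>(1 - y)\<^sup>2 = 1 - x\<close> into the fixed point equation
  \<open>y = (x + y\<^sup>2) / 2\<close>, which is a contraction of the self-adjoint part of the ball of radius
  \<open>norm x\<close>.
\<close>

lemma selfadjoint_sqrt_one_minus:
  fixes x :: "'a::unital_cstar_algebra"
  assumes sa: "star x = x" and x1: "norm x < 1"
  obtains b where "star b = b" "b * b = 1 - x"
proof -
  define S where "S = {y::'a. norm y \<le> norm x \<and> star y = y}"
  define F where "F y = (1/2) *\<^sub>R (x + y * y)" for y
  have "closed S"
    unfolding S_def
    by (intro closed_Collect_conj closed_Collect_le closed_Collect_eq continuous_intros continuous_star)
  then have "complete S" by (rule complete_eq_closed[THEN iffD2])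
  moreover have "S \<noteq> {}" by (auto simp: S_def intro!: exI[of _ 0])
  moreover have "F ` S \<subseteq> S"
  proof safe
    fix y assume y: "y \<in> S"
    then have "norm (y * y) \<le> norm x * norm x"
      unfolding S_def by (metis (mono_tags, lifting) mem_Collect_eq norm_ge_zero mult_mono norm_mult_ineq order_trans)
    also have "\<dots> \<le> norm x * 1" using x1 by (intro mult_left_mono) auto
    finally have "norm (x + y * y) \<le> 2 * norm x" using norm_triangle_ineq[of x "y*y"] by linarith
    then show "F y \<in> S" using y sa unfolding S_def F_def
      by (simp add: star_scaleR star_add star_mult)
  qed
  moreover have "dist (F y) (F z) \<le> norm x * dist y z" if "y \<in> S" "z \<in> S" for y z
  proof -
    have "F y - F z = (1/2) *\<^sub>R (y * (y - z) + (y - z) * z)"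
      by (simp add: F_def algebra_simps)
    moreover have "norm (y * (y - z)) \<le> norm x * norm (y - z)" 
      using that by (intro order_trans[OF norm_mult_ineq] mult_right_mono) (auto simp: S_def)
    moreover have "norm ((y - z) * z) \<le> norm (y - z) * norm x" 
      using that by (intro order_trans[OF norm_mult_ineq] mult_left_mono) (auto simp: S_def)
    moreover have "norm (y * (y - z) + (y - z) * z) \<le> norm (y * (y - z)) + norm ((y - z) * z)"
      by (rule norm_triangle_ineq)
    ultimately show ?thesis by (simp add: dist_norm mult.commute)
  qed
  ultimately obtain y where y: "y \<in> S" "F y = y"
    using Banach_fix[of S "norm x" F] x1 by (metis norm_ge_zero)
  show thesis
  proof
    show "star (1 - y) = 1 - y" using y by (simp add: S_def star_diff)
    have "y + y = x + y * y" using y(2) unfolding F_def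
      by (metis scaleR_half_double scaleR_add_right scaleR_one)
    then show "(1 - y) * (1 - y) = 1 - x" by (simp add: algebra_simps)
  qed
qed

text \<open>
  For \<open>r > norm (star a * a)\<close> the element \<open>r - star a * a\<close> has a self-adjoint square root, so a
  positive functional is nonnegative there. Letting \<open>r\<close> decrease gives the bound.
\<close>

lemma positive_functional_le:
  fixes f :: "'a::unital_cstar_algebra \<Rightarrow> complex"
  assumes add: "\<And>x y. f (x + y) = f x + f y"
    and scale: "\<And>c x. f (scaleC c x) = c * f x"
    and pos: "\<And>x. 0 \<le> Re (f (star x * x))"
  shows "Re (f (star a * a)) \<le> (norm a)\<^sup>2 * Re (f 1)"
proof -
  define h where "h = star a * a"
  have sa: "star h = h" by (simp add: h_def star_mult star_star)
  have f1: "0 \<le> Re (f 1)" using pos[of 1] by simp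
  have diff: "f (x - y) = f x - f y" for x y
    by (metis add add_diff_cancel diff_add_cancel)
  have fR: "f (r *\<^sub>R x) = of_real r * f x" for r x
    by (metis scale scaleC_of_real)
  have step: "Re (f h) \<le> r * Re (f 1)" if r: "norm h < r" for r
  proof -
    have r0: "0 < r" using r norm_ge_zero[of h] by linarith
    have "norm ((1/r) *\<^sub>R h) < 1" using r r0 by simp
    then obtain b where b: "star b = b" "b * b = 1 - (1/r) *\<^sub>R h"
      using selfadjoint_sqrt_one_minus[of "(1/r) *\<^sub>R h"] sa by (auto simp: star_scaleR)
    have "0 \<le> Re (f (1 - (1/r) *\<^sub>R h))" using pos[of b] b by simp
    then have "Re (f h) / r \<le> Re (f 1)" by (simp add: diff fR)
    then show ?thesis using r0 by (simp add: field_simps)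
  qed
  have "Re (f h) \<le> norm h * Re (f 1)"
  proof (cases "Re (f 1) = 0")
    case True
    then show ?thesis using step[of "norm h + 1"] by simp
  next
    case False
    then have p: "0 < Re (f 1)" using f1 by simp
    have "Re (f h) / Re (f 1) \<le> norm h"
      by (rule dense_ge) (use step p in \<open>auto simp: field_simps\<close>)
    then show ?thesis using p by (simp add: field_simps)
  qed
  then show ?thesis by (simp add: h_def cstar_identity)
qed

section \<open>Adjoints and inner products of matrices\<close>

lemma dim_mat_adjoint [simp]:
  "dim_row (mat_adjoint A) = dim_col A" "dim_col (mat_adjoint A) = dim_row A"
  by (auto simp: mat_adjoint_def mat_of_rows_def)

lemma mat_adjoint_carrier [simp]: "A \<in> carrier_mat n m \<Longrightarrow> mat_adjoint A \<in> carrier_mat m n"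
  by (intro carrier_matI) auto

lemma mat_adjoint_index [simp]:
  "i < dim_col A \<Longrightarrow> j < dim_row A \<Longrightarrow> mat_adjoint (A::complex mat) $$ (i, j) = cnj (A $$ (j, i))"
  by (simp add: mat_adjoint_def mat_of_rows_index)

lemma mat_adjoint_mat_adjoint [simp]: "mat_adjoint (mat_adjoint (A::complex mat)) = A"
  by (rule eq_matI) auto

lemma mat_mult_index:
  "A \<in> carrier_mat n m \<Longrightarrow> B \<in> carrier_mat m p \<Longrightarrow> i < n \<Longrightarrow> j < p \<Longrightarrow>
    (A * B) $$ (i, j) = (\<Sum>k<m. A $$ (i, k) * B $$ (k, j))"
  by (auto simp: scalar_prod_def atLeast0LessThan)

lemma mult_mat_vec_index:
  "A \<in> carrier_mat n m \<Longrightarrow> v \<in> carrier_vec m \<Longrightarrow> i < n \<Longrightarrow> 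
    (A *\<^sub>v v) $ i = (\<Sum>k<m. A $$ (i, k) * v $ k)"
  by (auto simp: scalar_prod_def atLeast0LessThan)

lemma mat_adjoint_mult:
  fixes A B :: "complex mat"
  assumes "A \<in> carrier_mat n m" "B \<in> carrier_mat m p"
  shows "mat_adjoint (A * B) = mat_adjoint B * mat_adjoint A"
proof (rule eq_matI)
  fix i j assume ij: "i < dim_row (mat_adjoint B * mat_adjoint A)" "j < dim_col (mat_adjoint B * mat_adjoint A)"
  then have "i < p" "j < n" using assms by auto
  then show "mat_adjoint (A * B) $$ (i, j) = (mat_adjoint B * mat_adjoint A) $$ (i, j)"
    using assms 
    by (simp add: mat_mult_index[of _ n m _ p] mat_mult_index[of _ p m _ n] mult.commute
             del: index_mult_mat(1))
qed (use assms in auto)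

lemma mat_adjoint_add:
  fixes A B :: "complex mat"
  assumes "A \<in> carrier_mat n m" "B \<in> carrier_mat n m"
  shows "mat_adjoint (A + B) = mat_adjoint A + mat_adjoint B"
  by (rule eq_matI) (use assms in auto)

lemma mat_adjoint_smult:
  fixes A :: "complex mat"
  shows "mat_adjoint (c \<cdot>\<^sub>m A) = cnj c \<cdot>\<^sub>m mat_adjoint A"
  by (rule eq_matI) auto

lemma mat_adjoint_one [simp]: "mat_adjoint (1\<^sub>m n :: complex mat) = 1\<^sub>m n"
  by (rule eq_matI) auto

lemma minus_mat_eq:
  fixes X Y :: "complex mat"
  assumes "X \<in> carrier_mat n m" "Y \<in> carrier_mat n m"
  shows "X - Y = X + (-1) \<cdot>\<^sub>m Y"
  by (rule eq_matI) (use assms in auto)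

lemma minus_mat_closed:
  "X \<in> carrier_mat n m \<Longrightarrow> Y \<in> carrier_mat n m \<Longrightarrow> X - Y \<in> carrier_mat n m"
  by (intro carrier_matI) auto

lemma cscalar_prod_sum:
  "v \<in> carrier_vec n \<Longrightarrow> w \<in> carrier_vec n \<Longrightarrow> v \<bullet>c w = (\<Sum>i<n. v $ i * cnj (w $ i))"
  by (auto simp: scalar_prod_def atLeast0LessThan intro!: sum.cong)

lemma cscalar_prod_mat_adjoint:
  fixes A :: "complex mat"
  assumes A: "A \<in> carrier_mat n m" and v: "v \<in> carrier_vec m" and w: "w \<in> carrier_vec n"
  shows "(A *\<^sub>v v) \<bullet>c w = v \<bullet>c (mat_adjoint A *\<^sub>v w)"
proof -
  have "(A *\<^sub>v v) \<bullet>c w = (\<Sum>i<n. \<Sum>j<m. A $$ (i, j) * v $ j * cnj (w $ i))"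
    using assms by (simp add: cscalar_prod_sum[of _ n] mult_mat_vec_index[OF A v] sum_distrib_right 
       del: index_mult_mat_vec)
  also have "\<dots> = (\<Sum>j<m. \<Sum>i<n. A $$ (i, j) * v $ j * cnj (w $ i))" by (rule sum.swap)
  also have "\<dots> = v \<bullet>c (mat_adjoint A *\<^sub>v w)"
    using assms mult_mat_vec_carrier[of "mat_adjoint A" m n w]
    by (simp add: cscalar_prod_sum[of _ m] mult_mat_vec_index[of _ m n] sum_distrib_left 
       mult_ac del: index_mult_mat_vec)
  finally show ?thesis .
qed

lemma l2_norm_vec_L2_set: "v \<in> carrier_vec n \<Longrightarrow> l2_norm_vec v = L2_set (\<lambda>i. cmod (v $ i)) {..<n}"
  by (auto simp: l2_norm_vec_def L2_set_def)

lemma l2_norm_vec_nonneg [simp]: "0 \<le> l2_norm_vec v"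
  by (auto simp: l2_norm_vec_def sum_nonneg)

lemma cscalar_prod_self:
  assumes "v \<in> carrier_vec n"
  shows "v \<bullet>c v = of_real ((l2_norm_vec v)\<^sup>2)"
  using assms by (simp add: cscalar_prod_sum[of _ n] l2_norm_vec_def sum_nonneg complex_norm_square
      del: of_real_power)

lemma cscalar_prod_Cauchy_Schwarz:
  assumes "v \<in> carrier_vec n" "w \<in> carrier_vec n"
  shows "cmod (v \<bullet>c w) \<le> l2_norm_vec v * l2_norm_vec w"
proof -
  have "cmod (v \<bullet>c w) \<le> (\<Sum>i<n. \<bar>cmod (v $ i)\<bar> * \<bar>cmod (w $ i)\<bar>)"
    using assms by (simp add: cscalar_prod_sum[of _ n]) (rule order_trans[OF norm_sum], simp add: norm_mult)
  also have "\<dots> \<le> l2_norm_vec v * l2_norm_vec w"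
    using assms L2_set_mult_ineq[of "\<lambda>i. cmod (v $ i)" "\<lambda>i. cmod (w $ i)" "{..<n}"] 
    by (simp add: l2_norm_vec_L2_set[of _ n])
  finally show ?thesis .
qed

section \<open>The operator norm\<close>

text \<open>
  The operator norm is a supremum and enters only through its upper bounds, for which this
  predicate is easier to combine.
\<close>

definition op_bound :: "nat \<Rightarrow> complex mat \<Rightarrow> real \<Rightarrow> bool" where
  "op_bound n X C \<longleftrightarrow> (\<forall>v\<in>carrier_vec n. l2_norm_vec (X *\<^sub>v v) \<le> C * l2_norm_vec v)"

lemma op_boundD: "op_bound n X C \<Longrightarrow> v \<in> carrier_vec n \<Longrightarrow> l2_norm_vec (X *\<^sub>v v) \<le> C * l2_norm_vec v"
  by (simp add: op_bound_def)

lemma l2_norm_vec_smult: "l2_norm_vec (c \<cdot>\<^sub>v v) = cmod c * l2_norm_vec v"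
  by (simp add: l2_norm_vec_def norm_mult power_mult_distrib sum_distrib_left[symmetric] real_sqrt_mult)

lemma l2_norm_vec_add:
  assumes "v \<in> carrier_vec n" "w \<in> carrier_vec n"
  shows "l2_norm_vec (v + w) \<le> l2_norm_vec v + l2_norm_vec w"
proof -
  have "l2_norm_vec (v + w) = L2_set (\<lambda>i. cmod (v $ i + w $ i)) {..<n}"
    using assms by (auto simp: l2_norm_vec_L2_set[of _ n] intro!: L2_set_cong)
  also have "\<dots> \<le> L2_set (\<lambda>i. cmod (v $ i) + cmod (w $ i)) {..<n}"
    by (intro L2_set_mono) (auto intro: norm_triangle_ineq)
  also have "\<dots> \<le> l2_norm_vec v + l2_norm_vec w"
    using assms by (simp add: l2_norm_vec_L2_set[of _ n] L2_set_triangle_ineq)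
  finally show ?thesis .
qed

lemma l2_norm_vec_zero [simp]: "l2_norm_vec (0\<^sub>v n) = 0"
  by (simp add: l2_norm_vec_def)

lemma op_bound_one: "op_bound n (1\<^sub>m n) 1"
  by (simp add: op_bound_def)

lemma op_bound_mono: "op_bound n X C \<Longrightarrow> C \<le> D \<Longrightarrow> op_bound n X D"
  unfolding op_bound_def by (meson l2_norm_vec_nonneg mult_right_mono order_trans)

lemma op_bound_zero: "op_bound n (0\<^sub>m n n) 0"
proof -
  have "0\<^sub>m n n *\<^sub>v v = (0\<^sub>v n :: complex vec)" if "v \<in> carrier_vec n" for v
    using that by (intro eq_vecI) auto
  then show ?thesis by (simp add: op_bound_def)
qed

lemma op_bound_add:
  assumes X: "X \<in> carrier_mat n n" and Y: "Y \<in> carrier_mat n n" and "op_bound n X C" "op_bound n Y D"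
  shows "op_bound n (X + Y) (C + D)"
  unfolding op_bound_def
proof
  fix v :: "complex vec" assume v: "v \<in> carrier_vec n"
  have "l2_norm_vec ((X + Y) *\<^sub>v v) \<le> l2_norm_vec (X *\<^sub>v v) + l2_norm_vec (Y *\<^sub>v v)"
    using X Y v by (simp add: add_mult_distrib_mat_vec[OF X Y v] l2_norm_vec_add[of _ n])
  then show "l2_norm_vec ((X + Y) *\<^sub>v v) \<le> (C + D) * l2_norm_vec v"
    using op_boundD[OF assms(3) v] op_boundD[OF assms(4) v] by (simp add: algebra_simps)
qed

lemma op_bound_mult:
  assumes X: "X \<in> carrier_mat n n" and Y: "Y \<in> carrier_mat n n" and "op_bound n X C" "op_bound n Y D" "0 \<le> C"
  shows "op_bound n (X * Y) (C * D)"
  unfolding op_bound_def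
proof
  fix v :: "complex vec" assume v: "v \<in> carrier_vec n"
  have "l2_norm_vec ((X * Y) *\<^sub>v v) \<le> C * l2_norm_vec (Y *\<^sub>v v)"
    using X Y v by (simp add: assoc_mult_mat_vec[OF X Y v] op_boundD[OF assms(3)])
  also have "\<dots> \<le> C * (D * l2_norm_vec v)"
    using op_boundD[OF assms(4) v] assms(5) by (intro mult_left_mono)
  finally show "l2_norm_vec ((X * Y) *\<^sub>v v) \<le> (C * D) * l2_norm_vec v" by (simp add: mult.assoc)
qed

lemma op_bound_smult:
  assumes X: "X \<in> carrier_mat n n" and "op_bound n X C"
  shows "op_bound n (c \<cdot>\<^sub>m X) (cmod c * C)"
  unfolding op_bound_def
proof
  fix v :: "complex vec" assume v: "v \<in> carrier_vec n"
  have "(c \<cdot>\<^sub>m X) *\<^sub>v v = c \<cdot>\<^sub>v (X *\<^sub>v v)"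
    using X v by (intro eq_vecI) (auto simp: scalar_prod_def sum_distrib_left mult.assoc)
  then show "l2_norm_vec ((c \<cdot>\<^sub>m X) *\<^sub>v v) \<le> (cmod c * C) * l2_norm_vec v"
    using op_boundD[OF assms(2) v] by (simp add: l2_norm_vec_smult mult.assoc mult_left_mono)
qed

text \<open>
  Moving \<open>X\<close> across the inner product gives \<open>\<parallel>X\<^sup>* v\<parallel>\<^sup>2 \<le> C \<parallel>X\<^sup>* v\<parallel> \<parallel>v\<parallel>\<close>.
\<close>

lemma op_bound_adjoint:
  assumes X: "X \<in> carrier_mat n n" and b: "op_bound n X C" and C: "0 \<le> C"
  shows "op_bound n (mat_adjoint X) C"
  unfolding op_bound_def
proof
  fix v :: "complex vec" assume v: "v \<in> carrier_vec n"
  define w where "w = mat_adjoint X *\<^sub>v v"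
  have w: "w \<in> carrier_vec n" using X v unfolding w_def by (intro mult_mat_vec_carrier) auto
  have "of_real ((l2_norm_vec w)\<^sup>2) = w \<bullet>c w" using cscalar_prod_self[OF w] by simp
  also have "\<dots> = (X *\<^sub>v w) \<bullet>c v" 
    using cscalar_prod_mat_adjoint[OF X w v] by (simp add: w_def)
  finally have "(l2_norm_vec w)\<^sup>2 = cmod ((X *\<^sub>v w) \<bullet>c v)"
    by (metis norm_of_real abs_of_nonneg zero_le_power2)
  also have "\<dots> \<le> l2_norm_vec (X *\<^sub>v w) * l2_norm_vec v"
    using X v w by (intro cscalar_prod_Cauchy_Schwarz[of _ n]) auto
  also have "\<dots> \<le> (C * l2_norm_vec w) * l2_norm_vec v"
    by (intro mult_right_mono op_boundD[OF b w]) auto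
  finally have "l2_norm_vec w * l2_norm_vec w \<le> l2_norm_vec w * (C * l2_norm_vec v)"
    by (simp add: power2_eq_square mult_ac)
  then show "l2_norm_vec (mat_adjoint X *\<^sub>v v) \<le> C * l2_norm_vec v"
    using C by (cases "l2_norm_vec w = 0") (auto simp: w_def[symmetric] mult_le_cancel_left order_less_le)
qed

text \<open>
  The Frobenius norm is an operator bound, so the set in \<open>matrix_op_norm\<close> is bounded above.
\<close>

lemma op_bound_exists:
  assumes X: "X \<in> carrier_mat n n"
  shows "\<exists>C. op_bound n X C"
proof -
  define F where "F = L2_set (\<lambda>i. L2_set (\<lambda>j. cmod (X $$ (i, j))) {..<n}) {..<n}"
  have "op_bound n X F" unfolding op_bound_def
  proof
    fix v :: "complex vec" assume v: "v \<in> carrier_vec n"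
    have Xv: "X *\<^sub>v v \<in> carrier_vec n" using X v by simp
    have "cmod ((X *\<^sub>v v) $ i) \<le> l2_norm_vec v * L2_set (\<lambda>j. cmod (X $$ (i, j))) {..<n}" if i: "i < n" for i
    proof -
      have "cmod ((X *\<^sub>v v) $ i) \<le> (\<Sum>k<n. \<bar>cmod (v $ k)\<bar> * \<bar>cmod (X $$ (i, k))\<bar>)"
        unfolding mult_mat_vec_index[OF X v i]
        by (rule order_trans[OF norm_sum]) (simp add: norm_mult mult.commute)
      also have "\<dots> \<le> l2_norm_vec v * L2_set (\<lambda>j. cmod (X $$ (i, j))) {..<n}"
        unfolding l2_norm_vec_L2_set[OF v] by (rule L2_set_mult_ineq)
      finally show ?thesis .
    qed
    then have "l2_norm_vec (X *\<^sub>v v) \<le> L2_set (\<lambda>i. l2_norm_vec v * L2_set (\<lambda>j. cmod (X $$ (i, j))) {..<n}) {..<n}"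
      unfolding l2_norm_vec_L2_set[OF Xv] by (intro L2_set_mono) auto
    also have "\<dots> = F * l2_norm_vec v"
      by (simp add: F_def L2_set_right_distrib mult.commute)
    finally show "l2_norm_vec (X *\<^sub>v v) \<le> F * l2_norm_vec v" .
  qed
  then show ?thesis ..
qed

lemma matrix_op_norm_le:
  assumes "op_bound n X C" "0 \<le> C"
  shows "matrix_op_norm n X \<le> C"
  unfolding matrix_op_norm_def
proof (rule cSup_least)
  show "{l2_norm_vec (X *\<^sub>v v) |v. v \<in> carrier_vec n \<and> l2_norm_vec v \<le> 1} \<noteq> {}"
    by (auto intro!: exI[of _ "0\<^sub>v n"])
next
  fix x assume "x \<in> {l2_norm_vec (X *\<^sub>v v) |v. v \<in> carrier_vec n \<and> l2_norm_vec v \<le> 1}"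
  then obtain v where v: "v \<in> carrier_vec n" "l2_norm_vec v \<le> 1" "x = l2_norm_vec (X *\<^sub>v v)" by auto
  then show "x \<le> C" using op_boundD[OF assms(1) v(1)] assms(2) mult_left_mono[of "l2_norm_vec v" 1 C] by simp
qed

lemma op_bound_matrix_op_norm:
  assumes X: "X \<in> carrier_mat n n"
  shows "op_bound n X (matrix_op_norm n X)"
  unfolding op_bound_def
proof
  fix v :: "complex vec" assume v: "v \<in> carrier_vec n"
  obtain C where C: "op_bound n X C" using op_bound_exists[OF X] ..
  then have C': "op_bound n X (max C 0)"
    unfolding op_bound_def by (meson l2_norm_vec_nonneg max.cobounded1 mult_right_mono order_trans)
  show "l2_norm_vec (X *\<^sub>v v) \<le> matrix_op_norm n X * l2_norm_vec v"
  proof (cases "l2_norm_vec v = 0")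
    case True
    then show ?thesis using op_boundD[OF C v] by simp
  next
    case False
    then have p: "0 < l2_norm_vec v" by (simp add: order_less_le)
    \<comment> \<open>The supremum ranges over the unit ball, so \<open>v\<close> is normalized first.\<close>
    define u where "u = of_real (1 / l2_norm_vec v) \<cdot>\<^sub>v v"
    have u: "u \<in> carrier_vec n" "l2_norm_vec u = 1"
      using v p by (auto simp: u_def l2_norm_vec_smult norm_divide)
    have "X *\<^sub>v u = of_real (1 / l2_norm_vec v) \<cdot>\<^sub>v (X *\<^sub>v v)"
      unfolding u_def using X v by (rule mult_mat_vec)
    then have e: "l2_norm_vec (X *\<^sub>v u) = l2_norm_vec (X *\<^sub>v v) / l2_norm_vec v"
      using p by (simp add: l2_norm_vec_smult norm_divide)
    have "l2_norm_vec (X *\<^sub>v u) \<le> matrix_op_norm n X"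
      unfolding matrix_op_norm_def
    proof (rule cSup_upper)
      show "l2_norm_vec (X *\<^sub>v u) \<in> {l2_norm_vec (X *\<^sub>v v) |v. v \<in> carrier_vec n \<and> l2_norm_vec v \<le> 1}"
        using u by auto
      show "bdd_above {l2_norm_vec (X *\<^sub>v v) |v. v \<in> carrier_vec n \<and> l2_norm_vec v \<le> 1}"
      proof (rule bdd_aboveI)
        fix x assume "x \<in> {l2_norm_vec (X *\<^sub>v v) |v. v \<in> carrier_vec n \<and> l2_norm_vec v \<le> 1}"
        then obtain v where v: "v \<in> carrier_vec n" "l2_norm_vec v \<le> 1" "x = l2_norm_vec (X *\<^sub>v v)" by auto
        then show "x \<le> max C 0" 
          using op_boundD[OF C' v(1)] mult_left_mono[of "l2_norm_vec v" 1 "max C 0"] by simp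
      qed
    qed
    then show ?thesis using p by (simp add: e field_simps)
  qed
qed

section \<open>The normalized Hilbert-Schmidt norm\<close>

definition mat_2norm :: "nat \<Rightarrow> complex mat \<Rightarrow> real" where
  "mat_2norm n = trace_2norm (matrix_algebra n) (normalized_trace n)"

lemma normalized_trace_add:
  "X \<in> carrier_mat n n \<Longrightarrow> Y \<in> carrier_mat n n \<Longrightarrow> 
    normalized_trace n (X + Y) = normalized_trace n X + normalized_trace n Y"
  by (simp add: normalized_trace_def sum.distrib add_divide_distrib)

lemma normalized_trace_smult:
  "X \<in> carrier_mat n n \<Longrightarrow> normalized_trace n (c \<cdot>\<^sub>m X) = c * normalized_trace n X"
  by (simp add: normalized_trace_def sum_distrib_left)

lemma normalized_trace_one: "0 < n \<Longrightarrow> normalized_trace n (1\<^sub>m n) = 1"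
  by (simp add: normalized_trace_def)

lemma normalized_trace_comm:
  "X \<in> carrier_mat n n \<Longrightarrow> Y \<in> carrier_mat n n \<Longrightarrow> normalized_trace n (X * Y) = normalized_trace n (Y * X)"
  unfolding normalized_trace_def
  by (simp add: mat_mult_index[of _ n n _ n] del: index_mult_mat(1))
     (subst sum.swap, simp add: mult.commute)

lemma normalized_trace_adjoint_mult:
  assumes "X \<in> carrier_mat n n"
  shows "normalized_trace n (mat_adjoint X * X) =
    of_real ((\<Sum>j<n. \<Sum>i<n. (cmod (X $$ (i, j)))\<^sup>2) / n)"
  using assms
  by (simp add: normalized_trace_def mat_mult_index[of _ n n _ n] complex_norm_square mult.commute
      del: index_mult_mat(1) of_real_power)

text \<open>
  Since the norm is that of the vector of entries, scaled by the dimension, the triangle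
  inequality and the Cauchy-Schwarz bound for the trace are those of \<open>L2_set\<close>.
\<close>

lemma mat_2norm_eq:
  assumes "X \<in> carrier_mat n n"
  shows "mat_2norm n X = L2_set (\<lambda>(i, j). cmod (X $$ (i, j))) ({..<n} \<times> {..<n}) / sqrt n"
proof -
  have "mat_2norm n X = sqrt ((\<Sum>j<n. \<Sum>i<n. (cmod (X $$ (i, j)))\<^sup>2) / n)"
    using assms normalized_trace_adjoint_mult[OF assms]
    by (simp add: mat_2norm_def trace_2norm_def matrix_algebra_def)
  also have "(\<Sum>j<n. \<Sum>i<n. (cmod (X $$ (i, j)))\<^sup>2) = (\<Sum>(i,j)\<in>{..<n}\<times>{..<n}. (cmod (X $$ (i, j)))\<^sup>2)"
    by (subst sum.swap) (simp add: sum.cartesian_product)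
  finally show ?thesis
    by (simp add: L2_set_def real_sqrt_divide case_prod_unfold)
qed

lemma mat_2norm_cols:
  assumes "X \<in> carrier_mat n n"
  shows "(mat_2norm n X)\<^sup>2 = (\<Sum>j<n. (l2_norm_vec (col X j))\<^sup>2) / n"
  using assms normalized_trace_adjoint_mult[OF assms]
  by (simp add: mat_2norm_def trace_2norm_def matrix_algebra_def l2_norm_vec_def sum_nonneg)

lemma mat_2norm_nonneg [simp]: "X \<in> carrier_mat n n \<Longrightarrow> 0 \<le> mat_2norm n X"
  by (simp add: mat_2norm_eq L2_set_nonneg)

lemma mat_2norm_zero [simp]: "mat_2norm n (0\<^sub>m n n) = 0"
  by (simp add: mat_2norm_eq L2_set_0' case_prod_unfold)

lemma mat_2norm_add:
  assumes "X \<in> carrier_mat n n" "Y \<in> carrier_mat n n"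
  shows "mat_2norm n (X + Y) \<le> mat_2norm n X + mat_2norm n Y"
proof -
  let ?I = "{..<n} \<times> {..<n}"
  have "L2_set (\<lambda>(i, j). cmod ((X + Y) $$ (i, j))) ?I
      \<le> L2_set (\<lambda>p. (\<lambda>(i, j). cmod (X $$ (i, j))) p + (\<lambda>(i, j). cmod (Y $$ (i, j))) p) ?I"
    using assms by (intro L2_set_mono) (auto intro: norm_triangle_ineq)
  also have "\<dots> \<le> L2_set (\<lambda>(i, j). cmod (X $$ (i, j))) ?I + L2_set (\<lambda>(i, j). cmod (Y $$ (i, j))) ?I"
    by (rule L2_set_triangle_ineq)
  finally show ?thesis using assms by (simp add: mat_2norm_eq add_divide_distrib[symmetric] divide_right_mono)
qed

lemma mat_2norm_smult:
  assumes "X \<in> carrier_mat n n"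
  shows "mat_2norm n (c \<cdot>\<^sub>m X) = cmod c * mat_2norm n X"
proof -
  let ?I = "{..<n} \<times> {..<n}"
  have "L2_set (\<lambda>(i, j). cmod ((c \<cdot>\<^sub>m X) $$ (i, j))) ?I = L2_set (\<lambda>p. cmod c * (\<lambda>(i, j). cmod (X $$ (i, j))) p) ?I"
    using assms by (intro L2_set_cong) (auto simp: norm_mult)
  then show ?thesis using assms by (simp add: mat_2norm_eq L2_set_right_distrib)
qed

lemma mat_2norm_adjoint:
  assumes "X \<in> carrier_mat n n"
  shows "mat_2norm n (mat_adjoint X) = mat_2norm n X"
proof -
  have "normalized_trace n (X * mat_adjoint X) = normalized_trace n (mat_adjoint X * X)"
    using assms by (intro normalized_trace_comm) auto
  then show ?thesis by (simp add: mat_2norm_def trace_2norm_def matrix_algebra_def)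
qed

lemma mat_2norm_minus_commute:
  assumes "X \<in> carrier_mat n n" "Y \<in> carrier_mat n n"
  shows "mat_2norm n (X - Y) = mat_2norm n (Y - X)"
proof -
  have "X - Y = (-1) \<cdot>\<^sub>m (Y - X)" by (rule eq_matI) (use assms in auto)
  then show ?thesis using mat_2norm_smult[OF minus_mat_closed[OF assms(2,1)], of "-1"] by simp
qed

text \<open>
  The columns of \<open>X * Y\<close> are the images of those of \<open>Y\<close>. With \<open>mat_2norm_mult_right\<close> this is
  what makes the null families an ideal among the bounded ones.
\<close>

lemma mat_2norm_mult_left:
  assumes X: "X \<in> carrier_mat n n" and Y: "Y \<in> carrier_mat n n" and b: "op_bound n X C" and C: "0 \<le> C"
  shows "mat_2norm n (X * Y) \<le> C * mat_2norm n Y"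
proof -
  have "(mat_2norm n (X * Y))\<^sup>2 \<le> (\<Sum>j<n. (C * l2_norm_vec (col Y j))\<^sup>2) / n"
  proof -
    have "col (X * Y) j = X *\<^sub>v col Y j" if "j < n" for j
      using X Y that by (intro eq_vecI) auto
    then have "(l2_norm_vec (col (X * Y) j))\<^sup>2 \<le> (C * l2_norm_vec (col Y j))\<^sup>2" if "j < n" for j
      using Y that by (simp, intro power_mono op_boundD[OF b]) auto
    then show ?thesis unfolding mat_2norm_cols[OF mult_carrier_mat[OF X Y]]
      by (intro divide_right_mono sum_mono) auto
  qed
  also have "\<dots> = (C * mat_2norm n Y)\<^sup>2"
    using Y by (simp add: mat_2norm_cols power_mult_distrib sum_distrib_left)
  finally show ?thesis
    by (rule power2_le_imp_le) (use C Y in auto)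
qed

lemma mat_2norm_mult_right:
  assumes X: "X \<in> carrier_mat n n" and Y: "Y \<in> carrier_mat n n" and b: "op_bound n X C" and C: "0 \<le> C"
  shows "mat_2norm n (Y * X) \<le> C * mat_2norm n Y"
proof -
  have "mat_2norm n (Y * X) = mat_2norm n (mat_adjoint X * mat_adjoint Y)"
    using X Y by (simp add: mat_adjoint_mult[symmetric] mat_2norm_adjoint)
  also have "\<dots> \<le> C * mat_2norm n (mat_adjoint Y)"
    using X Y by (intro mat_2norm_mult_left op_bound_adjoint b C) auto
  finally show ?thesis using Y by (simp add: mat_2norm_adjoint)
qed

lemma mat_2norm_le_op_bound:
  assumes X: "X \<in> carrier_mat n n" and b: "op_bound n X C" and C: "0 \<le> C"
  shows "mat_2norm n X \<le> C"
proof -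
  have "mat_2norm n (1\<^sub>m n) \<le> 1"
    by (cases "n = 0") (auto simp: mat_2norm_def trace_2norm_def matrix_algebra_def normalized_trace_def)
  then have "C * mat_2norm n (1\<^sub>m n) \<le> C * 1" using C by (intro mult_left_mono)
  then show ?thesis using mat_2norm_mult_left[OF X _ b C, of "1\<^sub>m n"] X by simp
qed

lemma mat_2norm_eq_0D:
  assumes X: "X \<in> carrier_mat n n" and z: "mat_2norm n X = 0"
  shows "X = 0\<^sub>m n n"
proof (cases "n = 0")
  case False
  have "L2_set (\<lambda>(i, j). cmod (X $$ (i, j))) ({..<n} \<times> {..<n}) = 0"
    using z False by (simp add: mat_2norm_eq[OF X])
  then have "\<forall>i<n. \<forall>j<n. X $$ (i, j) = 0"
    by (subst (asm) L2_set_eq_0_iff) auto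
  then show ?thesis using X by (intro eq_matI) auto
qed (use X in auto)

lemma normalized_trace_le_2norm:
  assumes X: "X \<in> carrier_mat n n"
  shows "cmod (normalized_trace n X) \<le> mat_2norm n X"
proof (cases "n = 0")
  case True
  then show ?thesis using X by (simp add: normalized_trace_def)
next
  case False
  have "cmod (\<Sum>i<n. X $$ (i, i)) \<le> (\<Sum>i<n. \<bar>cmod (X $$ (i, i))\<bar> * \<bar>1\<bar>)"
    by (rule order_trans[OF norm_sum]) simp
  also have "\<dots> \<le> L2_set (\<lambda>i. cmod (X $$ (i, i))) {..<n} * L2_set (\<lambda>i. 1) {..<n}"
    by (rule L2_set_mult_ineq)
  also have "L2_set (\<lambda>i. 1) {..<n} = sqrt n" by (simp add: L2_set_constant)
  also have "L2_set (\<lambda>i. cmod (X $$ (i, i))) {..<n} 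
      = L2_set (\<lambda>(i, j). cmod (X $$ (i, j))) ((\<lambda>i. (i, i)) ` {..<n})"
    unfolding L2_set_def by (subst sum.reindex) (auto simp: inj_on_def)
  also have "\<dots> \<le> L2_set (\<lambda>(i, j). cmod (X $$ (i, j))) ({..<n} \<times> {..<n})"
    unfolding L2_set_def by (intro real_sqrt_le_mono sum_mono2) auto
  also have "\<dots> * sqrt n = mat_2norm n X * n"
    using False by (simp add: mat_2norm_eq[OF X] field_simps)
  finally show ?thesis using False
    by (simp add: normalized_trace_def norm_divide field_simps mult_right_mono)
qed

section \<open>Representations on finite-dimensional spaces\<close>

text \<open>
  Representations that need not be unital, so that zero blocks are allowed.
\<close>

definition star_rep :: "nat \<Rightarrow> ('a::unital_cstar_algebra \<Rightarrow> complex mat) \<Rightarrow> bool" where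
  "star_rep n \<phi> \<longleftrightarrow>
     (\<forall>x. \<phi> x \<in> carrier_mat n n) \<and>
     (\<forall>x y. \<phi> (x + y) = \<phi> x + \<phi> y) \<and>
     (\<forall>c x. \<phi> (scaleC c x) = c \<cdot>\<^sub>m \<phi> x) \<and>
     (\<forall>x y. \<phi> (x * y) = \<phi> x * \<phi> y) \<and>
     (\<forall>x. \<phi> (star x) = mat_adjoint (\<phi> x))"

lemma unital_star_hom_matrix_algebra:
  "unital_star_hom \<phi> (matrix_algebra n) \<longleftrightarrow> star_rep n \<phi> \<and> \<phi> 1 = 1\<^sub>m n"
  by (auto simp: unital_star_hom_def star_rep_def matrix_algebra_def)

lemma star_repD:
  assumes "star_rep n \<phi>"
  shows "\<phi> x \<in> carrier_mat n n" "\<phi> (x + y) = \<phi> x + \<phi> y" "\<phi> (scaleC c x) = c \<cdot>\<^sub>m \<phi> x"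
    "\<phi> (x * y) = \<phi> x * \<phi> y" "\<phi> (star x) = mat_adjoint (\<phi> x)"
  using assms by (auto simp: star_rep_def)

text \<open>
  A vector \<open>v\<close> defines the positive functional \<open>x \<mapsto> \<langle>\<phi>(x) v, v\<rangle>\<close>, whose value at \<open>star a * a\<close> is
  the square of the norm of \<open>\<phi>(a) v\<close>. Its value at \<open>1\<close> is at most the squared norm of \<open>v\<close>,
  because \<open>\<phi> 1\<close> is a projection.
\<close>

lemma star_rep_op_bound:
  fixes \<phi> :: "'a::unital_cstar_algebra \<Rightarrow> complex mat"
  assumes rep: "star_rep n \<phi>"
  shows "op_bound n (\<phi> a) (norm a)"
  unfolding op_bound_def
proof
  fix v :: "complex vec" assume v: "v \<in> carrier_vec n"
  note R = star_repD[OF rep]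
  have c: "\<phi> x *\<^sub>v v \<in> carrier_vec n" for x using R(1) v by (rule mult_mat_vec_carrier)
  define f where "f x = (\<phi> x *\<^sub>v v) \<bullet>c v" for x
  have sq: "f (star x * x) = of_real ((l2_norm_vec (\<phi> x *\<^sub>v v))\<^sup>2)" for x
  proof -
    have "f (star x * x) = (mat_adjoint (\<phi> x) *\<^sub>v (\<phi> x *\<^sub>v v)) \<bullet>c v"
      unfolding f_def R(4,5) using R(1) v
      by (subst assoc_mult_mat_vec[of _ n n _ n]) auto
    also have "\<dots> = (\<phi> x *\<^sub>v v) \<bullet>c (\<phi> x *\<^sub>v v)"
      using cscalar_prod_mat_adjoint[OF mat_adjoint_carrier[OF R(1)] c v, of x x] by simp
    also have "\<dots> = of_real ((l2_norm_vec (\<phi> x *\<^sub>v v))\<^sup>2)" by (rule cscalar_prod_self[OF c])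
    finally show ?thesis .
  qed
  have "Re (f (star a * a)) \<le> (norm a)\<^sup>2 * Re (f 1)"
  proof (rule positive_functional_le)
    show "f (x + y) = f x + f y" for x y
      using v c R(1) 
      by (simp add: f_def R(2) add_mult_distrib_mat_vec[OF R(1) R(1) v] add_scalar_prod_distrib[OF c c])
    show "f (scaleC z x) = z * f x" for z x
    proof -
      have "(z \<cdot>\<^sub>m \<phi> x) *\<^sub>v v = z \<cdot>\<^sub>v (\<phi> x *\<^sub>v v)"
        using R(1)[of x] v by (intro eq_vecI) (auto simp: scalar_prod_def sum_distrib_left mult.assoc)
      then show ?thesis using c[of x] v by (simp add: f_def R(3))
    qed
    show "0 \<le> Re (f (star x * x))" for x by (simp add: sq)
  qed
  then have main: "(l2_norm_vec (\<phi> a *\<^sub>v v))\<^sup>2 \<le> (norm a)\<^sup>2 * Re (f 1)" by (simp add: sq)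
  have f1: "Re (f 1) = (l2_norm_vec (\<phi> 1 *\<^sub>v v))\<^sup>2" using sq[of 1] by simp
  have "Re (f 1) \<le> cmod (f 1)" by (rule complex_Re_le_cmod)
  also have "\<dots> \<le> l2_norm_vec (\<phi> 1 *\<^sub>v v) * l2_norm_vec v"
    unfolding f_def by (rule cscalar_prod_Cauchy_Schwarz[OF c v])
  finally have "l2_norm_vec (\<phi> 1 *\<^sub>v v) * l2_norm_vec (\<phi> 1 *\<^sub>v v) \<le> l2_norm_vec (\<phi> 1 *\<^sub>v v) * l2_norm_vec v"
    by (simp add: f1 power2_eq_square)
  then have "l2_norm_vec (\<phi> 1 *\<^sub>v v) \<le> l2_norm_vec v"
    by (cases "l2_norm_vec (\<phi> 1 *\<^sub>v v) = 0") (auto simp: mult_le_cancel_left order_less_le)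
  then have "Re (f 1) \<le> (l2_norm_vec v)\<^sup>2" unfolding f1 by (intro power_mono) auto
  with main have "(l2_norm_vec (\<phi> a *\<^sub>v v))\<^sup>2 \<le> (norm a * l2_norm_vec v)\<^sup>2"
    by (simp add: power_mult_distrib) (meson mult_left_mono order_trans zero_le_power2)
  then show "l2_norm_vec (\<phi> a *\<^sub>v v) \<le> norm a * l2_norm_vec v"
    by (rule power2_le_imp_le) auto
qed

lemma normalized_trace_star_rep_le:
  assumes "star_rep n \<phi>"
  shows "cmod (normalized_trace n (\<phi> a)) \<le> norm a"
proof -
  have "cmod (normalized_trace n (\<phi> a)) \<le> mat_2norm n (\<phi> a)"
    by (rule normalized_trace_le_2norm[OF star_repD(1)[OF assms]])
  also have "\<dots> \<le> norm a"
    by (rule mat_2norm_le_op_bound[OF star_repD(1)[OF assms] star_rep_op_bound[OF assms]]) simp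
  finally show ?thesis .
qed

lemma matrix_trace_tracial_state:
  fixes \<phi> :: "'a::unital_cstar_algebra \<Rightarrow> complex mat"
  assumes rep: "star_rep n \<phi>" and one: "\<phi> 1 = 1\<^sub>m n" and n: "0 < n"
  shows "tracial_state (normalized_trace n \<circ> \<phi>)"
proof -
  note R = star_repD[OF rep]
  show ?thesis unfolding tracial_state_def
    by (auto simp: R(2-5) normalized_trace_add[OF R(1) R(1)] normalized_trace_smult[OF R(1)]
        normalized_trace_adjoint_mult[OF R(1)] one normalized_trace_one[OF n] sum_nonneg
        simp del: of_real_sum of_real_divide
        intro: normalized_trace_comm[OF R(1) R(1)])
qed

lemma matricial_tracial_state_iff:
  "matricial_tracial_state \<tau> \<longleftrightarrow> 
    (\<exists>n \<phi>. 0 < n \<and> star_rep n \<phi> \<and> \<phi> 1 = 1\<^sub>m n \<and> \<tau> = normalized_trace n \<circ> \<phi>)"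
  unfolding matricial_tracial_state_def unital_star_hom_matrix_algebra
  using matrix_trace_tracial_state by metis

text \<open>For the projection \<open>p = \<phi> 1\<close>, the defect \<open>(1 - p)\<^sup>*(1 - p)\<close> is \<open>1 - p\<close> itself.\<close>

lemma star_rep_unit_defect:
  assumes rep: "star_rep n \<phi>" and n: "0 < n"
  shows "(mat_2norm n (\<phi> 1 + (-1) \<cdot>\<^sub>m 1\<^sub>m n))\<^sup>2 = 1 - Re (normalized_trace n (\<phi> 1))"
proof -
  note R = star_repD[OF rep]
  define p where "p = \<phi> 1"
  define d where "d = p + (-1) \<cdot>\<^sub>m 1\<^sub>m n"
  have p: "p \<in> carrier_mat n n" "p * p = p" "mat_adjoint p = p"
    using R(1)[of 1] R(4)[of 1 1] R(5)[of 1] by (auto simp: p_def)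
  have d: "d \<in> carrier_mat n n" "mat_adjoint d = d"
    using p by (auto simp: d_def mat_adjoint_add[of _ n n] mat_adjoint_smult)
  have "d * d = (p + (-1) \<cdot>\<^sub>m 1\<^sub>m n) * p + (p + (-1) \<cdot>\<^sub>m 1\<^sub>m n) * ((-1) \<cdot>\<^sub>m 1\<^sub>m n)"
    unfolding d_def using p by (intro mult_add_distrib_mat) auto
  also have "(p + (-1) \<cdot>\<^sub>m 1\<^sub>m n) * p = p + (-1) \<cdot>\<^sub>m p"
    using p by (subst add_mult_distrib_mat[of _ n n]) (auto simp: mult_smult_assoc_mat[of _ n n])
  also have "(p + (-1) \<cdot>\<^sub>m 1\<^sub>m n) * ((-1) \<cdot>\<^sub>m 1\<^sub>m n) = (-1) \<cdot>\<^sub>m d"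
    using p by (subst mult_smult_distrib[of _ n n]) (auto simp: d_def)
  finally have "d * d = (p + (-1) \<cdot>\<^sub>m p) + (-1) \<cdot>\<^sub>m d" .
  then have "normalized_trace n (d * d) = - normalized_trace n d"
    using p d by (simp add: normalized_trace_add normalized_trace_smult)
  also have "normalized_trace n d = normalized_trace n p - 1"
    using p n by (simp add: d_def normalized_trace_add normalized_trace_smult normalized_trace_one)
  finally have e: "normalized_trace n (mat_adjoint d * d) = 1 - normalized_trace n p" by (simp add: d(2))
  have "(mat_2norm n d)\<^sup>2 = Re (normalized_trace n (mat_adjoint d * d))"
    using normalized_trace_adjoint_mult[OF d(1)]
    by (simp add: mat_2norm_def trace_2norm_def matrix_algebra_def sum_nonneg)
  then show ?thesis unfolding e by (simp add: d_def p_def)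
qed

lemma star_rep_unital_if_trace_one:
  assumes rep: "star_rep n \<phi>" and n: "0 < n" and t: "normalized_trace n (\<phi> 1) = 1"
  shows "\<phi> 1 = 1\<^sub>m n"
proof -
  note c = star_repD(1)[OF rep, of 1]
  have "mat_2norm n (\<phi> 1 + (-1) \<cdot>\<^sub>m 1\<^sub>m n) = 0"
    using star_rep_unit_defect[OF rep n] t by simp
  then have z: "\<phi> 1 + (-1) \<cdot>\<^sub>m 1\<^sub>m n = 0\<^sub>m n n" using c by (intro mat_2norm_eq_0D) auto
  show ?thesis
  proof (rule eq_matI)
    fix i j assume ij: "i < dim_row (1\<^sub>m n :: complex mat)" "j < dim_col (1\<^sub>m n :: complex mat)"
    have "(\<phi> 1 + (-1) \<cdot>\<^sub>m 1\<^sub>m n) $$ (i, j) = 0" unfolding z using ij by simp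
    then show "\<phi> 1 $$ (i, j) = 1\<^sub>m n $$ (i, j)" using ij c by (simp split: if_splits)
  qed (use c in auto)
qed

section \<open>Block sums\<close>

text \<open>
  Traces of block sums add up without the normalization.
\<close>

definition mat_trace :: "nat \<Rightarrow> complex mat \<Rightarrow> complex" where
  "mat_trace n X = (\<Sum>i<n. X $$ (i, i))"

lemma normalized_trace_eq: "normalized_trace n X = mat_trace n X / of_nat n"
  by (simp add: normalized_trace_def mat_trace_def)

lemma sum_lessThan_add:
  fixes f :: "nat \<Rightarrow> 'b::comm_monoid_add"
  shows "(\<Sum>i<n + m. f i) = (\<Sum>i<n. f i) + (\<Sum>i<m. f (n + i))"
  by (induction m) (auto simp: add.assoc)

text \<open>
  Block diagonal matrices. Only the size and the trace of the sum matter later, so the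
  blocks are hidden behind the existential statement.
\<close>

lemma star_rep_sum:
  fixes \<phi> \<psi> :: "'a::unital_cstar_algebra \<Rightarrow> complex mat"
  assumes "star_rep n \<phi>" "star_rep m \<psi>"
  obtains \<theta> where "star_rep (n + m) \<theta>"
    "\<And>a. mat_trace (n + m) (\<theta> a) = mat_trace n (\<phi> a) + mat_trace m (\<psi> a)"
proof
  note R = star_repD[OF assms(1)] and S = star_repD[OF assms(2)]
  define \<theta> where "\<theta> a = four_block_mat (\<phi> a) (0\<^sub>m n m) (0\<^sub>m m n) (\<psi> a)" for a
  have dims [simp]: "dim_row (\<phi> a) = n" "dim_col (\<phi> a) = n" "dim_row (\<psi> a) = m" "dim_col (\<psi> a) = m" for a
    using R(1)[of a] S(1)[of a] by auto
  show "star_rep (n + m) \<theta>"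
    unfolding star_rep_def
  proof (intro conjI allI)
    fix x y c
    show "\<theta> x \<in> carrier_mat (n + m) (n + m)" unfolding \<theta>_def using R(1) S(1) by simp
    show "\<theta> (x + y) = \<theta> x + \<theta> y"
      unfolding \<theta>_def R(2) S(2) by (rule eq_matI) auto
    show "\<theta> (scaleC c x) = c \<cdot>\<^sub>m \<theta> x"
      unfolding \<theta>_def R(3) S(3) by (rule eq_matI) auto
    show "\<theta> (star x) = mat_adjoint (\<theta> x)"
      unfolding \<theta>_def R(5) S(5) by (rule eq_matI) auto
    show "\<theta> (x * y) = \<theta> x * \<theta> y"
      unfolding \<theta>_def R(4) S(4)
      by (subst mult_four_block_mat[OF R(1) zero_carrier_mat zero_carrier_mat S(1)
            R(1) zero_carrier_mat zero_carrier_mat S(1)]) (simp add: R(4)[symmetric] S(4)[symmetric] left_mult_zero_mat[OF R(1)] left_mult_zero_mat[OF S(1)] right_mult_zero_mat[OF R(1)] right_mult_zero_mat[OF S(1)] left_add_zero_mat[OF S(1)] right_add_zero_mat[OF R(1)])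
  qed
  show "mat_trace (n + m) (\<theta> a) = mat_trace n (\<phi> a) + mat_trace m (\<psi> a)" for a
    by (simp add: mat_trace_def sum_lessThan_add \<theta>_def)
qed

lemma star_rep_zero: "star_rep n (\<lambda>_. 0\<^sub>m n n)"
proof -
  have "mat_adjoint (0\<^sub>m n n) = (0\<^sub>m n n :: complex mat)" by (rule eq_matI) auto
  then show ?thesis by (simp add: star_rep_def)
qed

lemma star_rep_multiple:
  fixes \<phi> :: "'a::unital_cstar_algebra \<Rightarrow> complex mat"
  assumes "star_rep m \<phi>"
  shows "\<exists>\<psi> :: 'a \<Rightarrow> complex mat. star_rep (q * m) \<psi> \<and> (\<forall>a. mat_trace (q * m) (\<psi> a) = of_nat q * mat_trace m (\<phi> a))"
proof (induction q)
  case 0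
  show ?case using star_rep_zero[of 0] by (auto simp: mat_trace_def)
next
  case (Suc q)
  then obtain \<psi> :: "'a \<Rightarrow> complex mat" where p: "star_rep (q * m) \<psi>" "\<And>a. mat_trace (q * m) (\<psi> a) = of_nat q * mat_trace m (\<phi> a)"
    by blast
  obtain \<theta> :: "'a \<Rightarrow> complex mat" where "star_rep (m + q * m) \<theta>" 
    "\<And>a. mat_trace (m + q * m) (\<theta> a) = mat_trace m (\<phi> a) + mat_trace (q * m) (\<psi> a)"
    using star_rep_sum[OF assms p(1)] by blast
  then show ?case 
    by (intro exI[of _ \<theta>]) (simp add: p(2) distrib_right)
qed

lemma star_rep_padded:
  fixes \<phi> :: "'a::unital_cstar_algebra \<Rightarrow> complex mat"
  assumes "star_rep m \<phi>"
  obtains \<psi> :: "'a \<Rightarrow> complex mat" where "star_rep n \<psi>"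
    "\<And>a. mat_trace n (\<psi> a) = of_nat (n div m) * mat_trace m (\<phi> a)"
proof -
  obtain \<psi> :: "'a \<Rightarrow> complex mat" where p: "star_rep (n div m * m) \<psi>" 
    "\<And>a. mat_trace (n div m * m) (\<psi> a) = of_nat (n div m) * mat_trace m (\<phi> a)"
    using star_rep_multiple[OF assms] by blast
  obtain \<theta> :: "'a \<Rightarrow> complex mat" where "star_rep (n div m * m + n mod m) \<theta>" 
    "\<And>a. mat_trace (n div m * m + n mod m) (\<theta> a) = mat_trace (n div m * m) (\<psi> a) + mat_trace (n mod m) (0\<^sub>m (n mod m) (n mod m))"
    using star_rep_sum[OF p(1) star_rep_zero[of "n mod m"]] by blast
  moreover have "mat_trace (n mod m) (0\<^sub>m (n mod m) (n mod m)) = 0" by (simp add: mat_trace_def)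
  ultimately show thesis using that[of \<theta>] by (simp add: p(2))
qed

section \<open>Ultraproducts of matrix algebras\<close>

text \<open>
  By the Cauchy-Schwarz inequality the trace does not see families that are null in the 2-norm.
\<close>

lemma tendsto_normalized_trace_2norm_close:
  assumes "\<forall>\<^sub>F i in \<alpha>. a i \<in> carrier_mat (k i) (k i) \<and> b i \<in> carrier_mat (k i) (k i)"
    and ab: "((\<lambda>i. mat_2norm (k i) (a i - b i)) \<longlongrightarrow> 0) \<alpha>"
    and l: "((\<lambda>i. normalized_trace (k i) (b i)) \<longlongrightarrow> l) \<alpha>"
  shows "((\<lambda>i. normalized_trace (k i) (a i)) \<longlongrightarrow> l) \<alpha>"
proof -
  have "((\<lambda>i. normalized_trace (k i) (a i) - normalized_trace (k i) (b i)) \<longlongrightarrow> 0) \<alpha>"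
  proof (rule Lim_null_comparison[OF _ ab])
    show "\<forall>\<^sub>F i in \<alpha>. cmod (normalized_trace (k i) (a i) - normalized_trace (k i) (b i)) \<le> mat_2norm (k i) (a i - b i)"
    proof (rule eventually_mono[OF assms(1)], elim conjE)
      fix i assume xi: "a i \<in> carrier_mat (k i) (k i)" "b i \<in> carrier_mat (k i) (k i)"
      have "normalized_trace (k i) (a i) - normalized_trace (k i) (b i) = normalized_trace (k i) (a i - b i)"
        using xi by (simp add: minus_mat_eq[OF xi] normalized_trace_add normalized_trace_smult)
      then show "cmod (normalized_trace (k i) (a i) - normalized_trace (k i) (b i)) \<le> mat_2norm (k i) (a i - b i)"
        using normalized_trace_le_2norm[OF minus_mat_closed[OF xi]] by simp
    qed
  qed
  from tendsto_add[OF this l] show ?thesis by simp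
qed

text \<open>
  The conditions on a family of representatives which say that its classes form a unital
  homomorphism into the ultraproduct (\<open>unital_star_hom_coset_iff\<close>). They refer only to
  limits along the filter, and can thus be moved between index sets.
\<close>

definition approximate_star_hom ::
  "'i filter \<Rightarrow> ('i \<Rightarrow> nat) \<Rightarrow> ('a::unital_cstar_algebra \<Rightarrow> 'i \<Rightarrow> complex mat) \<Rightarrow> bool" where
  "approximate_star_hom \<alpha> k s \<longleftrightarrow>
     (\<forall>x y. ((\<lambda>i. mat_2norm (k i) (s (x + y) i - (s x i + s y i))) \<longlongrightarrow> 0) \<alpha>) \<and>
     (\<forall>c x. ((\<lambda>i. mat_2norm (k i) (s (scaleC c x) i - c \<cdot>\<^sub>m s x i)) \<longlongrightarrow> 0) \<alpha>) \<and>
     (\<forall>x y. ((\<lambda>i. mat_2norm (k i) (s (x * y) i - s x i * s y i)) \<longlongrightarrow> 0) \<alpha>) \<and>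
     (\<forall>x. ((\<lambda>i. mat_2norm (k i) (s (star x) i - mat_adjoint (s x i))) \<longlongrightarrow> 0) \<alpha>) \<and>
     ((\<lambda>i. mat_2norm (k i) (s 1 i - 1\<^sub>m (k i))) \<longlongrightarrow> 0) \<alpha>"

lemma approximate_star_hom_filtermap:
  "approximate_star_hom (filtermap g \<alpha>) k s \<longleftrightarrow> approximate_star_hom \<alpha> (k \<circ> g) (\<lambda>a. s a \<circ> g)"
  by (simp add: approximate_star_hom_def filterlim_filtermap)

locale matrix_ultraproduct =
  fixes I :: "'i set" and \<alpha> :: "'i filter" and k :: "'i \<Rightarrow> nat"
  assumes eventually_index: "eventually (\<lambda>i. i \<in> I) \<alpha>" and proper: "\<alpha> \<noteq> bot"
begin

abbreviation P :: "('i \<Rightarrow> complex mat) normed_star_algebra" where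
  "P \<equiv> cstar_product I (\<lambda>i. matrix_algebra (k i))"

abbreviation J :: "('i \<Rightarrow> complex mat) set" where
  "J \<equiv> trace_null_ideal I \<alpha> (\<lambda>i. matrix_algebra (k i)) (\<lambda>i. normalized_trace (k i))"

abbreviation U :: "('i \<Rightarrow> complex mat) set normed_star_algebra" where
  "U \<equiv> tracial_ultraproduct I \<alpha> (\<lambda>i. matrix_algebra (k i)) (\<lambda>i. normalized_trace (k i))"

abbreviation coset :: "('i \<Rightarrow> complex mat) \<Rightarrow> ('i \<Rightarrow> complex mat) set" where
  "coset \<equiv> ultraproduct_coset I \<alpha> (\<lambda>i. matrix_algebra (k i)) (\<lambda>i. normalized_trace (k i))"

lemma coset_eq: "coset a = J +>\<^bsub>P\<^esub> a"
  by (simp add: ultraproduct_coset_def)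

lemma carrier_P:
  "a \<in> carrier P \<longleftrightarrow> a \<in> (\<Pi>\<^sub>E i\<in>I. carrier_mat (k i) (k i)) \<and> (\<exists>C\<ge>0. \<forall>i\<in>I. op_bound (k i) (a i) C)"
proof -
  have "(\<exists>C. \<forall>i\<in>I. matrix_op_norm (k i) (a i) \<le> C) \<longleftrightarrow> (\<exists>C\<ge>0. \<forall>i\<in>I. op_bound (k i) (a i) C)"
    if a: "a \<in> (\<Pi>\<^sub>E i\<in>I. carrier_mat (k i) (k i))"
  proof
    assume "\<exists>C. \<forall>i\<in>I. matrix_op_norm (k i) (a i) \<le> C"
    then obtain C where C: "\<And>i. i \<in> I \<Longrightarrow> matrix_op_norm (k i) (a i) \<le> C" by metis
    have "op_bound (k i) (a i) (max C 0)" if i: "i \<in> I" for i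
    proof (rule op_bound_mono)
      show "op_bound (k i) (a i) (matrix_op_norm (k i) (a i))"
        using a i by (intro op_bound_matrix_op_norm) (rule PiE_mem)
      show "matrix_op_norm (k i) (a i) \<le> max C 0" using C[OF i] by simp
    qed
    then show "\<exists>C\<ge>0. \<forall>i\<in>I. op_bound (k i) (a i) C" by (intro exI[of _ "max C 0"]) simp
  next
    assume "\<exists>C\<ge>0. \<forall>i\<in>I. op_bound (k i) (a i) C"
    then show "\<exists>C. \<forall>i\<in>I. matrix_op_norm (k i) (a i) \<le> C" by (metis matrix_op_norm_le)
  qed
  then show ?thesis unfolding cstar_product_def matrix_algebra_def by (simp cong: conj_cong)
qed

lemma P_ops:
  "\<one>\<^bsub>P\<^esub> = (\<lambda>i\<in>I. 1\<^sub>m (k i))" "\<zero>\<^bsub>P\<^esub> = (\<lambda>i\<in>I. 0\<^sub>m (k i) (k i))"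
  "a \<oplus>\<^bsub>P\<^esub> b = (\<lambda>i\<in>I. a i + b i)" "a \<otimes>\<^bsub>P\<^esub> b = (\<lambda>i\<in>I. a i * b i)"
  "c \<odot>\<^bsub>P\<^esub> a = (\<lambda>i\<in>I. c \<cdot>\<^sub>m a i)" "adj P a = (\<lambda>i\<in>I. mat_adjoint (a i))"
  by (auto simp: cstar_product_def matrix_algebra_def)

lemma P_index: "a \<in> carrier P \<Longrightarrow> i \<in> I \<Longrightarrow> a i \<in> carrier_mat (k i) (k i)"
  by (auto simp: carrier_P)

lemma P_eqI:
  "a \<in> carrier P \<Longrightarrow> b \<in> carrier P \<Longrightarrow> (\<And>i. i \<in> I \<Longrightarrow> a i = b i) \<Longrightarrow> a = b"
  unfolding carrier_P by (blast intro: PiE_ext)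

lemma P_bound:
  assumes "a \<in> carrier P"
  obtains C where "0 \<le> C" "\<And>i. i \<in> I \<Longrightarrow> op_bound (k i) (a i) C"
proof -
  obtain C where C: "0 \<le> C" "\<forall>i\<in>I. op_bound (k i) (a i) C" using assms unfolding carrier_P by metis
  show thesis by (rule that[OF C(1)]) (rule bspec[OF C(2)])
qed

lemma P_closed:
  assumes a: "a \<in> carrier P" and b: "b \<in> carrier P"
  shows "a \<oplus>\<^bsub>P\<^esub> b \<in> carrier P" "a \<otimes>\<^bsub>P\<^esub> b \<in> carrier P" "c \<odot>\<^bsub>P\<^esub> a \<in> carrier P" "adj P a \<in> carrier P"
proof -
  obtain C where C: "0 \<le> C" "\<And>i. i \<in> I \<Longrightarrow> op_bound (k i) (a i) C" using P_bound[OF a] by blast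
  obtain D where D: "0 \<le> D" "\<And>i. i \<in> I \<Longrightarrow> op_bound (k i) (b i) D" using P_bound[OF b] by blast
  note ab = P_index[OF a] P_index[OF b]
  show "a \<oplus>\<^bsub>P\<^esub> b \<in> carrier P" unfolding carrier_P P_ops
    using ab C D by (auto intro!: exI[of _ "C + D"] op_bound_add)
  show "a \<otimes>\<^bsub>P\<^esub> b \<in> carrier P" unfolding carrier_P P_ops
    using ab C D by (auto intro!: exI[of _ "C * D"] op_bound_mult mult_carrier_mat[OF ab])
  show "c \<odot>\<^bsub>P\<^esub> a \<in> carrier P" unfolding carrier_P P_ops
    using ab C by (auto intro!: exI[of _ "cmod c * C"] op_bound_smult)
  show "adj P a \<in> carrier P" unfolding carrier_P P_ops
    using ab C by (auto intro!: exI[of _ "C"] op_bound_adjoint)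
qed

lemma P_one_zero_closed: "\<one>\<^bsub>P\<^esub> \<in> carrier P" "\<zero>\<^bsub>P\<^esub> \<in> carrier P"
  by (auto simp: carrier_P P_ops intro!: exI[of _ 1] op_bound_one op_bound_mono[OF op_bound_zero])

lemma P_neg: "a \<in> carrier P \<Longrightarrow> ((-1) \<odot>\<^bsub>P\<^esub> a) \<oplus>\<^bsub>P\<^esub> a = \<zero>\<^bsub>P\<^esub>"
proof (rule P_eqI)
  fix i assume "a \<in> carrier P" "i \<in> I"
  then show "(((-1) \<odot>\<^bsub>P\<^esub> a) \<oplus>\<^bsub>P\<^esub> a) i = \<zero>\<^bsub>P\<^esub> i"
    using P_index[of a i] by (intro eq_matI) (auto simp: P_ops)
qed (auto intro: P_closed P_one_zero_closed)

lemma abelian_group_P: "abelian_group P"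
proof (rule abelian_groupI)
  fix x y z assume x: "x \<in> carrier P" and y: "y \<in> carrier P" and z: "z \<in> carrier P"
  show "x \<oplus>\<^bsub>P\<^esub> y \<oplus>\<^bsub>P\<^esub> z = x \<oplus>\<^bsub>P\<^esub> (y \<oplus>\<^bsub>P\<^esub> z)"
    unfolding P_ops by (intro restrict_ext) (simp add: assoc_add_mat[OF P_index[OF x] P_index[OF y] P_index[OF z]])
  show "x \<oplus>\<^bsub>P\<^esub> y = y \<oplus>\<^bsub>P\<^esub> x"
    unfolding P_ops by (intro restrict_ext comm_add_mat[OF P_index[OF x] P_index[OF y]])
next
  fix x assume x: "x \<in> carrier P"
  show "\<zero>\<^bsub>P\<^esub> \<oplus>\<^bsub>P\<^esub> x = x"
  proof (rule P_eqI)
    show "(\<zero>\<^bsub>P\<^esub> \<oplus>\<^bsub>P\<^esub> x) i = x i" if "i \<in> I" for i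
      using P_index[OF x that] that by (simp add: P_ops)
  qed (use x P_closed P_one_zero_closed in auto)
  show "\<exists>y\<in>carrier P. y \<oplus>\<^bsub>P\<^esub> x = \<zero>\<^bsub>P\<^esub>"
    using P_neg[OF x] P_closed(3)[OF x x] by blast
qed (auto intro: P_closed P_one_zero_closed)

lemma ring_P: "ring P"
proof (rule ringI[OF abelian_group_P])
  show "Group.monoid P"
  proof (rule monoidI)
    fix x y z assume x: "x \<in> carrier P" and y: "y \<in> carrier P" and z: "z \<in> carrier P"
    show "x \<otimes>\<^bsub>P\<^esub> y \<otimes>\<^bsub>P\<^esub> z = x \<otimes>\<^bsub>P\<^esub> (y \<otimes>\<^bsub>P\<^esub> z)"
      unfolding P_ops by (intro restrict_ext) (simp add: assoc_mult_mat[OF P_index[OF x] P_index[OF y] P_index[OF z]])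
  next
    fix x assume x: "x \<in> carrier P"
    show "\<one>\<^bsub>P\<^esub> \<otimes>\<^bsub>P\<^esub> x = x"
    proof (rule P_eqI)
      show "(\<one>\<^bsub>P\<^esub> \<otimes>\<^bsub>P\<^esub> x) i = x i" if "i \<in> I" for i
        using P_index[OF x that] that by (simp add: P_ops)
    qed (use x P_closed P_one_zero_closed in auto)
    show "x \<otimes>\<^bsub>P\<^esub> \<one>\<^bsub>P\<^esub> = x"
    proof (rule P_eqI)
      show "(x \<otimes>\<^bsub>P\<^esub> \<one>\<^bsub>P\<^esub>) i = x i" if "i \<in> I" for i
        using P_index[OF x that] that by (simp add: P_ops)
    qed (use x P_closed P_one_zero_closed in auto)
  qed (auto intro: P_closed P_one_zero_closed)
  fix x y z assume x: "x \<in> carrier P" and y: "y \<in> carrier P" and z: "z \<in> carrier P"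
  show "(x \<oplus>\<^bsub>P\<^esub> y) \<otimes>\<^bsub>P\<^esub> z = x \<otimes>\<^bsub>P\<^esub> z \<oplus>\<^bsub>P\<^esub> y \<otimes>\<^bsub>P\<^esub> z"
    unfolding P_ops
    by (intro restrict_ext) (simp add: add_mult_distrib_mat[OF P_index[OF x] P_index[OF y] P_index[OF z]])
  show "z \<otimes>\<^bsub>P\<^esub> (x \<oplus>\<^bsub>P\<^esub> y) = z \<otimes>\<^bsub>P\<^esub> x \<oplus>\<^bsub>P\<^esub> z \<otimes>\<^bsub>P\<^esub> y"
    unfolding P_ops
    by (intro restrict_ext) (simp add: mult_add_distrib_mat[OF P_index[OF z] P_index[OF x] P_index[OF y]])
qed

lemma J_iff: "a \<in> J \<longleftrightarrow> a \<in> carrier P \<and> ((\<lambda>i. mat_2norm (k i) (a i)) \<longlongrightarrow> 0) \<alpha>"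
  by (simp add: trace_null_ideal_def mat_2norm_def)

lemma J_if_dominated:
  assumes "a \<in> carrier P" "(f \<longlongrightarrow> 0) \<alpha>" "\<And>i. i \<in> I \<Longrightarrow> mat_2norm (k i) (a i) \<le> f i"
  shows "a \<in> J"
  unfolding J_iff
proof
  show "((\<lambda>i. mat_2norm (k i) (a i)) \<longlongrightarrow> 0) \<alpha>"
    by (rule tendsto_sandwich[OF _ _ tendsto_const assms(2)];
        rule eventually_mono[OF eventually_index]) (use assms P_index[OF assms(1)] in auto)
qed fact

lemma P_minus_inv: "a \<in> carrier P \<Longrightarrow> \<ominus>\<^bsub>P\<^esub> a = (-1) \<odot>\<^bsub>P\<^esub> a"
  using abelian_group.minus_equality[OF abelian_group_P P_neg] P_closed(3) by blast

lemma J_add: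
  assumes a: "a \<in> J" and b: "b \<in> J"
  shows "a \<oplus>\<^bsub>P\<^esub> b \<in> J"
proof (rule J_if_dominated)
  show "((\<lambda>i. mat_2norm (k i) (a i) + mat_2norm (k i) (b i)) \<longlongrightarrow> 0) \<alpha>"
    using a b tendsto_add[of _ 0 _ _ 0] by (auto simp: J_iff)
  show "mat_2norm (k i) ((a \<oplus>\<^bsub>P\<^esub> b) i) \<le> mat_2norm (k i) (a i) + mat_2norm (k i) (b i)" if "i \<in> I" for i
    using a b that P_index[of a i] P_index[of b i] by (simp add: J_iff P_ops mat_2norm_add)
qed (use a b P_closed in \<open>auto simp: J_iff\<close>)

lemma J_smult:
  assumes a: "a \<in> J"
  shows "c \<odot>\<^bsub>P\<^esub> a \<in> J"
proof (rule J_if_dominated)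
  show "((\<lambda>i. cmod c * mat_2norm (k i) (a i)) \<longlongrightarrow> 0) \<alpha>"
    using a tendsto_mult_right_zero by (auto simp: J_iff)
  show "mat_2norm (k i) ((c \<odot>\<^bsub>P\<^esub> a) i) \<le> cmod c * mat_2norm (k i) (a i)" if "i \<in> I" for i
    using a that P_index[of a i] by (simp add: J_iff P_ops mat_2norm_smult)
qed (use a P_closed in \<open>auto simp: J_iff\<close>)

lemma J_mult:
  assumes a: "a \<in> J" and x: "x \<in> carrier P"
  shows "a \<otimes>\<^bsub>P\<^esub> x \<in> J" "x \<otimes>\<^bsub>P\<^esub> a \<in> J"
proof -
  obtain C where C: "0 \<le> C" "\<And>i. i \<in> I \<Longrightarrow> op_bound (k i) (x i) C" using P_bound[OF x] by blast
  have aP: "a \<in> carrier P" using a by (simp add: J_iff)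
  have lim: "((\<lambda>i. C * mat_2norm (k i) (a i)) \<longlongrightarrow> 0) \<alpha>"
    using a tendsto_mult_right_zero by (auto simp: J_iff)
  show "a \<otimes>\<^bsub>P\<^esub> x \<in> J"
    by (rule J_if_dominated[OF P_closed(2)[OF aP x] lim])
       (simp add: P_ops mat_2norm_mult_right C P_index[OF aP] P_index[OF x])
  show "x \<otimes>\<^bsub>P\<^esub> a \<in> J"
    by (rule J_if_dominated[OF P_closed(2)[OF x aP] lim])
       (simp add: P_ops mat_2norm_mult_left C P_index[OF aP] P_index[OF x])
qed

lemma ideal_J: "ideal J P"
proof (rule idealI[OF ring_P])
  interpret abelian_group P by (rule abelian_group_P)
  show "subgroup J (add_monoid P)"
  proof (rule add.subgroupI)
    show "J \<subseteq> carrier P" by (auto simp: J_iff)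
    have "\<zero>\<^bsub>P\<^esub> \<in> J"
      by (rule J_if_dominated[OF _ tendsto_const]) (simp_all add: P_one_zero_closed, simp add: P_ops)
    then show "J \<noteq> {}" by blast
    show "\<ominus>\<^bsub>P\<^esub> a \<in> J" if "a \<in> J" for a
      using that J_smult[OF that] by (simp add: P_minus_inv J_iff)
  qed (rule J_add)
qed (simp_all add: J_mult)

definition asymptotic :: "('i \<Rightarrow> complex mat) \<Rightarrow> ('i \<Rightarrow> complex mat) \<Rightarrow> bool" where
  "asymptotic a b \<longleftrightarrow> ((\<lambda>i. mat_2norm (k i) (a i - b i)) \<longlongrightarrow> 0) \<alpha>"

lemma asymptotic_cong:
  assumes "\<And>i. i \<in> I \<Longrightarrow> a i = a' i" "\<And>i. i \<in> I \<Longrightarrow> b i = b' i"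
  shows "asymptotic a b \<longleftrightarrow> asymptotic a' b'"
  unfolding asymptotic_def
  by (rule tendsto_cong) (rule eventually_mono[OF eventually_index], simp add: assms)

lemma coset_eq_iff:
  assumes a: "a \<in> carrier P" and b: "b \<in> carrier P"
  shows "coset a = coset b \<longleftrightarrow> asymptotic a b"
proof -
  interpret ideal J P by (rule ideal_J)
  have "coset a = coset b \<longleftrightarrow> a \<in> J +>\<^bsub>P\<^esub> b"
    using a b a_repr_independence' a_rcos_self unfolding coset_eq by blast
  also have "\<dots> \<longleftrightarrow> a \<oplus>\<^bsub>P\<^esub> \<ominus>\<^bsub>P\<^esub> b \<in> J"
    by (rule a_rcos_module[OF b a])
  also have "\<dots> \<longleftrightarrow> asymptotic (\<lambda>i. a i + (-1) \<cdot>\<^sub>m b i) (\<lambda>i. 0\<^sub>m (k i) (k i))"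
    unfolding J_iff P_minus_inv[OF b] asymptotic_def
  proof -
    have eq: "eventually (\<lambda>i. mat_2norm (k i) ((a \<oplus>\<^bsub>P\<^esub> (-1) \<odot>\<^bsub>P\<^esub> b) i) =
           mat_2norm (k i) (a i + (-1) \<cdot>\<^sub>m b i - 0\<^sub>m (k i) (k i))) \<alpha>"
    proof (rule eventually_mono[OF eventually_index])
      fix i assume i: "i \<in> I"
      have "a i + (-1) \<cdot>\<^sub>m b i - 0\<^sub>m (k i) (k i) = a i + (-1) \<cdot>\<^sub>m b i"
        using P_index[OF a i] P_index[OF b i] by (intro eq_matI) auto
      then show "mat_2norm (k i) ((a \<oplus>\<^bsub>P\<^esub> (-1) \<odot>\<^bsub>P\<^esub> b) i) =
           mat_2norm (k i) (a i + (-1) \<cdot>\<^sub>m b i - 0\<^sub>m (k i) (k i))" using i by (simp add: P_ops)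
    qed
    show "(a \<oplus>\<^bsub>P\<^esub> (-1) \<odot>\<^bsub>P\<^esub> b \<in> carrier P \<and>
        ((\<lambda>i. mat_2norm (k i) ((a \<oplus>\<^bsub>P\<^esub> (-1) \<odot>\<^bsub>P\<^esub> b) i)) \<longlongrightarrow> 0) \<alpha>) \<longleftrightarrow>
      ((\<lambda>i. mat_2norm (k i) (a i + (-1) \<cdot>\<^sub>m b i - 0\<^sub>m (k i) (k i))) \<longlongrightarrow> 0) \<alpha>"
      using P_closed(1)[OF a P_closed(3)[OF b b]] tendsto_cong[OF eq] by blast
  qed
  also have "\<dots> \<longleftrightarrow> asymptotic a b"
    unfolding asymptotic_def
  proof (rule tendsto_cong, rule eventually_mono[OF eventually_index])
    fix i assume i: "i \<in> I"
    have "a i + (-1) \<cdot>\<^sub>m b i - 0\<^sub>m (k i) (k i) = a i - b i"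
      using P_index[OF a i] P_index[OF b i] by (intro eq_matI) auto
    then show "mat_2norm (k i) (a i + (-1) \<cdot>\<^sub>m b i - 0\<^sub>m (k i) (k i)) = mat_2norm (k i) (a i - b i)" by simp
  qed
  finally show ?thesis .
qed

lemma coset_member:
  assumes a: "a \<in> carrier P" and x: "x \<in> coset a"
  shows "x \<in> carrier P" "coset x = coset a" "asymptotic x a"
proof -
  interpret ideal J P by (rule ideal_J)
  show xP: "x \<in> carrier P"
    using x a a_r_coset_subset_G[OF a_subset a] unfolding coset_eq by blast
  show e: "coset x = coset a"
    using x a a_repr_independence' unfolding coset_eq by blast
  then show "asymptotic x a" using coset_eq_iff[OF xP a] by simp
qed

lemma coset_self: "a \<in> carrier P \<Longrightarrow> a \<in> coset a"
  using abelian_subgroup.a_rcos_self[OF abelian_subgroupI3[OF ideal.axioms(1)[OF ideal_J] abelian_group_P]]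
  by (simp add: coset_eq)

lemma UN_coset_const:
  assumes a: "a \<in> carrier P" and "\<And>x. x \<in> coset a \<Longrightarrow> f x = f a"
  shows "(\<Union>x\<in>coset a. f x) = f a"
proof -
  have "(\<Union>x\<in>coset a. f x) = (\<Union>x\<in>coset a. f a)" by (rule SUP_cong[OF refl assms(2)])
  also have "\<dots> = f a" using coset_self[OF a] by (simp only: UN_constant) auto
  finally show ?thesis .
qed

lemma U_ops:
  assumes a: "a \<in> carrier P" and b: "b \<in> carrier P"
  shows "coset a \<oplus>\<^bsub>U\<^esub> coset b = coset (a \<oplus>\<^bsub>P\<^esub> b)"
    "coset a \<otimes>\<^bsub>U\<^esub> coset b = coset (a \<otimes>\<^bsub>P\<^esub> b)"
    "c \<odot>\<^bsub>U\<^esub> coset a = coset (c \<odot>\<^bsub>P\<^esub> a)"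
    "adj U (coset a) = coset (adj P a)"
    "\<one>\<^bsub>U\<^esub> = coset \<one>\<^bsub>P\<^esub>"
proof -
  interpret ideal J P by (rule ideal_J)
  have sm: "c \<odot>\<^bsub>P\<^esub> x \<in> carrier P" "adj P x \<in> carrier P" if "x \<in> carrier P" for x c
    using P_closed[OF that that] by auto
  show "coset a \<oplus>\<^bsub>U\<^esub> coset b = coset (a \<oplus>\<^bsub>P\<^esub> b)"
    using a b by (simp add: tracial_ultraproduct_def Let_def FactRing_def coset_eq a_rcos_sum)
  show "coset a \<otimes>\<^bsub>U\<^esub> coset b = coset (a \<otimes>\<^bsub>P\<^esub> b)"
    using a b by (simp add: tracial_ultraproduct_def Let_def FactRing_def coset_eq rcoset_mult_add)
  show "\<one>\<^bsub>U\<^esub> = coset \<one>\<^bsub>P\<^esub>"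
    by (simp add: tracial_ultraproduct_def Let_def FactRing_def coset_eq)
  show "c \<odot>\<^bsub>U\<^esub> coset a = coset (c \<odot>\<^bsub>P\<^esub> a)"
  proof -
    have "coset (c \<odot>\<^bsub>P\<^esub> x) = coset (c \<odot>\<^bsub>P\<^esub> a)" if x: "x \<in> coset a" for x
    proof -
      note m = coset_member[OF a x]
      have "((\<lambda>i. mat_2norm (k i) ((c \<odot>\<^bsub>P\<^esub> x) i - (c \<odot>\<^bsub>P\<^esub> a) i)) \<longlongrightarrow> 0) \<alpha>"
      proof (rule Lim_transform_eventually)
        show "((\<lambda>i. cmod c * mat_2norm (k i) (x i - a i)) \<longlongrightarrow> 0) \<alpha>"
          using m(3) unfolding asymptotic_def by (rule tendsto_mult_right_zero)
        show "\<forall>\<^sub>F i in \<alpha>. cmod c * mat_2norm (k i) (x i - a i) = mat_2norm (k i) ((c \<odot>\<^bsub>P\<^esub> x) i - (c \<odot>\<^bsub>P\<^esub> a) i)"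
        proof (rule eventually_mono[OF eventually_index])
          fix i assume i: "i \<in> I"
          note xi = P_index[OF m(1) i] P_index[OF a i]
          have "(c \<odot>\<^bsub>P\<^esub> x) i - (c \<odot>\<^bsub>P\<^esub> a) i = c \<cdot>\<^sub>m (x i - a i)"
            using xi i by (intro eq_matI) (auto simp: P_ops algebra_simps)
          then show "cmod c * mat_2norm (k i) (x i - a i) = mat_2norm (k i) ((c \<odot>\<^bsub>P\<^esub> x) i - (c \<odot>\<^bsub>P\<^esub> a) i)"
            using mat_2norm_smult[OF minus_mat_closed[OF xi]] by simp
        qed
      qed
      then show ?thesis using coset_eq_iff sm m(1) a unfolding asymptotic_def by blast
    qed
    then show ?thesis using UN_coset_const[OF a, of "\<lambda>x. coset (c \<odot>\<^bsub>P\<^esub> x)"]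
      by (simp add: tracial_ultraproduct_def Let_def)
  qed
  show "adj U (coset a) = coset (adj P a)"
  proof -
    have "coset (adj P x) = coset (adj P a)" if x: "x \<in> coset a" for x
    proof -
      note m = coset_member[OF a x]
      have "((\<lambda>i. mat_2norm (k i) (adj P x i - adj P a i)) \<longlongrightarrow> 0) \<alpha>"
      proof (rule Lim_transform_eventually)
        show "((\<lambda>i. mat_2norm (k i) (x i - a i)) \<longlongrightarrow> 0) \<alpha>"
          using m(3) unfolding asymptotic_def .
        show "\<forall>\<^sub>F i in \<alpha>. mat_2norm (k i) (x i - a i) = mat_2norm (k i) (adj P x i - adj P a i)"
        proof (rule eventually_mono[OF eventually_index])
          fix i assume i: "i \<in> I"
          note xi = P_index[OF m(1) i] P_index[OF a i]
          have "adj P x i - adj P a i = mat_adjoint (x i - a i)"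
            using xi i by (intro eq_matI) (auto simp: P_ops)
          then show "mat_2norm (k i) (x i - a i) = mat_2norm (k i) (adj P x i - adj P a i)"
            using mat_2norm_adjoint[OF minus_mat_closed[OF xi]] by simp
        qed
      qed
      then show ?thesis using coset_eq_iff sm m(1) a unfolding asymptotic_def by blast
    qed
    then show ?thesis using UN_coset_const[OF a, of "\<lambda>x. coset (adj P x)"]
      by (simp add: tracial_ultraproduct_def Let_def)
  qed
qed

lemma carrier_U: "X \<in> carrier U \<longleftrightarrow> (\<exists>a\<in>carrier P. X = coset a)"
  by (auto simp: tracial_ultraproduct_def Let_def FactRing_def A_RCOSETS_def' coset_eq)

text \<open>
  All operations of the ultraproduct are computed on representatives, and two classes agree
  exactly when the representatives are asymptotic.
\<close>

lemma unital_star_hom_coset_iff: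
  assumes s: "\<And>a. s a \<in> carrier P"
  shows "unital_star_hom (\<lambda>a. coset (s a)) U \<longleftrightarrow> approximate_star_hom \<alpha> k s"
proof -
  note ps = P_closed[OF s s] P_one_zero_closed(1)
  have r: "asymptotic (s x) (\<lambda>i\<in>I. f i) \<longleftrightarrow> ((\<lambda>i. mat_2norm (k i) (s x i - f i)) \<longlongrightarrow> 0) \<alpha>" for x f
    unfolding asymptotic_def[symmetric] by (rule asymptotic_cong) auto
  have cU: "coset (s x) \<in> carrier U" for x using s carrier_U by blast
  have "unital_star_hom (\<lambda>a. coset (s a)) U \<longleftrightarrow>
     (\<forall>x y. asymptotic (s (x + y)) (s x \<oplus>\<^bsub>P\<^esub> s y)) \<and>
     (\<forall>c x. asymptotic (s (scaleC c x)) (c \<odot>\<^bsub>P\<^esub> s x)) \<and>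
     (\<forall>x y. asymptotic (s (x * y)) (s x \<otimes>\<^bsub>P\<^esub> s y)) \<and>
     (\<forall>x. asymptotic (s (star x)) (adj P (s x))) \<and>
     asymptotic (s 1) \<one>\<^bsub>P\<^esub>"
    unfolding unital_star_hom_def U_ops[OF s s]
    using s cU by (simp add: coset_eq_iff[OF s] ps)
  also have "\<dots> \<longleftrightarrow> approximate_star_hom \<alpha> k s"
    unfolding P_ops r approximate_star_hom_def ..
  finally show ?thesis .
qed

text \<open>
  The limit along one representative is the limit along all of them, which resolves the
  definite description in \<open>limit_trace\<close>.
\<close>

lemma limit_trace_coset:
  assumes a: "a \<in> carrier P" and l: "((\<lambda>i. normalized_trace (k i) (a i)) \<longlongrightarrow> l) \<alpha>"
  shows "limit_trace \<alpha> (\<lambda>i. normalized_trace (k i)) (coset a) = l"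
  unfolding limit_trace_def
proof (rule the_equality)
  show "\<exists>a\<in>coset a. ((\<lambda>i. normalized_trace (k i) (a i)) \<longlongrightarrow> l) \<alpha>"
    using coset_self[OF a] l by blast
next
  fix l' assume "\<exists>a\<in>coset a. ((\<lambda>i. normalized_trace (k i) (a i)) \<longlongrightarrow> l') \<alpha>"
  then obtain x where x: "x \<in> coset a" "((\<lambda>i. normalized_trace (k i) (x i)) \<longlongrightarrow> l') \<alpha>" by blast
  note m = coset_member[OF a x(1)]
  have "((\<lambda>i. normalized_trace (k i) (x i)) \<longlongrightarrow> l) \<alpha>"
  proof (rule tendsto_normalized_trace_2norm_close[OF _ _ l])
    show "\<forall>\<^sub>F i in \<alpha>. x i \<in> carrier_mat (k i) (k i) \<and> a i \<in> carrier_mat (k i) (k i)"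
      by (rule eventually_mono[OF eventually_index]) (simp add: P_index m(1) a)
  qed (use m(3) in \<open>simp add: asymptotic_def\<close>)
  then show "l' = l" using x(2) proper tendsto_unique by blast
qed

end

section \<open>Ultrafilters\<close>

text \<open>
  Zorn's lemma for the proper filters below \<open>F\<close>: the infimum of a chain of proper filters is
  proper, and a minimal proper filter decides every set.
\<close>

lemma ultrafilter_below:
  fixes F :: "'i filter"
  assumes "F \<noteq> bot"
  obtains \<alpha> where "\<alpha> \<le> F" "ultrafilter_on UNIV \<alpha>"
proof -
  define A where "A = {G. G \<noteq> bot \<and> G \<le> F}"
  have "\<exists>m\<in>A. \<forall>a\<in>A. m \<ge> a \<longrightarrow> a = m"
  proof (rule predicate_Zorn)
    show "partial_order_on A (relation_of (\<lambda>x y. x \<ge> y) A)"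
      by (rule partial_order_on_relation_ofI) auto
  next
    show "\<exists>u\<in>A. \<forall>a\<in>C. a \<ge> u" if C: "C \<in> Chains (relation_of (\<lambda>x y. x \<ge> y) A)" for C
    proof -
      have sub: "C \<subseteq> A" using C by (auto simp: Chains_def relation_of_def)
      have tot: "x \<le> y \<or> y \<le> x" if "x \<in> C" "y \<in> C" for x y
        using C that by (auto simp: Chains_def relation_of_def)
      show "\<exists>u\<in>A. \<forall>a\<in>C. a \<ge> u"
      proof (cases "C = {}")
        case True
        then show ?thesis using assms by (auto simp: A_def)
      next
        case False
        have "eventually P (Inf C) \<longleftrightarrow> (\<exists>b\<in>C. eventually P b)" for P
          by (rule eventually_Inf_base[OF False]) (metis tot inf.absorb1 inf.absorb2 order_refl)
        then have "Inf C \<noteq> bot"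
          using sub by (auto simp: trivial_limit_def A_def)
        moreover have "Inf C \<le> F" using False sub by (auto simp: A_def intro: Inf_lower2)
        ultimately show ?thesis using Inf_lower by (intro bexI[of _ "Inf C"]) (auto simp: A_def)
      qed
    qed
  qed
  then obtain \<alpha> where a: "\<alpha> \<in> A" and max: "\<And>G. G \<in> A \<Longrightarrow> G \<le> \<alpha> \<Longrightarrow> G = \<alpha>" by blast
  have "ultrafilter_on UNIV \<alpha>" unfolding ultrafilter_on_def
  proof (intro conjI allI)
    show "\<alpha> \<noteq> bot" using a by (simp add: A_def)
    show "\<forall>\<^sub>F i in \<alpha>. i \<in> UNIV" by simp
    fix E
    show "(\<forall>\<^sub>F i in \<alpha>. i \<in> E) \<or> (\<forall>\<^sub>F i in \<alpha>. i \<notin> E)"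
    proof (cases "inf \<alpha> (principal E) = bot")
      case True
      then have "\<forall>\<^sub>F i in inf \<alpha> (principal E). False" by simp
      then show ?thesis by (simp add: eventually_inf_principal)
    next
      case False
      then have "inf \<alpha> (principal E) = \<alpha>" using a by (intro max) (auto simp: A_def intro: le_infI1)
      moreover have "\<forall>\<^sub>F i in inf \<alpha> (principal E). i \<in> E" by (simp add: eventually_inf_principal)
      ultimately show ?thesis by simp
    qed
  qed
  moreover have "\<alpha> \<le> F" using a by (simp add: A_def)
  ultimately show thesis using that by blast
qed

lemma nontrivial_ultrafilter_on_UNIV:
  assumes "\<alpha> \<le> sequentially" "ultrafilter_on UNIV \<alpha>"
  shows "nontrivial_ultrafilter_on (UNIV :: nat set) \<alpha>"
  unfolding nontrivial_ultrafilter_on_def ultrafilter_on_def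
proof (intro conjI exI[of _ "\<lambda>n. {n..}"])
  show "\<forall>n. {n..} \<subseteq> UNIV \<and> (\<forall>\<^sub>F i in \<alpha>. i \<in> {n..})"
    using filter_leD[OF assms(1)] eventually_ge_at_top by auto
  show "(\<Inter>n::nat. {n..}) = {}" by (auto intro: exI[of _ "Suc _"]) (metis Suc_n_not_le_n)
qed (use assms in \<open>auto simp: ultrafilter_on_def\<close>)

lemma nontrivial_ultrafilter_on_filtermap:
  assumes "nontrivial_ultrafilter_on I \<alpha>" and g: "inj g"
  shows "nontrivial_ultrafilter_on (g ` I) (filtermap g \<alpha>)"
proof -
  obtain E :: "nat \<Rightarrow> 'a set" where E: "\<And>n. E n \<subseteq> I" "\<And>n. \<forall>\<^sub>F i in \<alpha>. i \<in> E n" "(\<Inter>n. E n) = {}"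
    and u: "ultrafilter_on I \<alpha>" "infinite I"
    using assms unfolding nontrivial_ultrafilter_on_def by blast
  show ?thesis unfolding nontrivial_ultrafilter_on_def
  proof (intro conjI exI[of _ "\<lambda>n. g ` E n"] allI)
    show "infinite (g ` I)" using u(2) g by (metis finite_imageD inj_on_subset subset_UNIV)
    show "ultrafilter_on (g ` I) (filtermap g \<alpha>)"
      unfolding ultrafilter_on_def
    proof (intro conjI allI)
      show "filtermap g \<alpha> \<noteq> bot" using u by (simp add: ultrafilter_on_def filtermap_bot_iff)
      show "\<forall>\<^sub>F i in filtermap g \<alpha>. i \<in> g ` I" 
        using u by (auto simp: ultrafilter_on_def eventually_filtermap elim: eventually_mono)
      fix S
      show "(\<forall>\<^sub>F i in filtermap g \<alpha>. i \<in> S) \<or> (\<forall>\<^sub>F i in filtermap g \<alpha>. i \<notin> S)"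
        using u(1) unfolding ultrafilter_on_def eventually_filtermap by (auto dest: spec[of _ "g -` S"])
    qed
    fix n
    show "g ` E n \<subseteq> g ` I" using E by auto
    show "\<forall>\<^sub>F i in filtermap g \<alpha>. i \<in> g ` E n"
      unfolding eventually_filtermap by (rule eventually_mono[OF E(2)[of n]]) simp
  next
    show "(\<Inter>n. g ` E n) = {}"
    proof -
      have "(\<Inter>n. g ` E n) = g ` (\<Inter>n. E n)" using g by (simp add: image_INT[of g UNIV])
      then show ?thesis by (simp add: E(3))
    qed
  qed
qed

text \<open>
  By compactness the values have a cluster point, and for an ultrafilter a cluster point is a limit.
\<close>

lemma ultrafilter_convergent:
  fixes f :: "'i \<Rightarrow> complex"
  assumes "ultrafilter_on UNIV \<alpha>" "\<forall>\<^sub>F i in \<alpha>. cmod (f i) \<le> C"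
  obtains l where "(f \<longlongrightarrow> l) \<alpha>"
proof -
  have nb: "filtermap f \<alpha> \<noteq> bot" using assms by (simp add: ultrafilter_on_def filtermap_bot_iff)
  have "eventually (\<lambda>x. x \<in> cball 0 C) (filtermap f \<alpha>)" using assms(2) by (simp add: eventually_filtermap)
  then obtain l where l: "inf (nhds l) (filtermap f \<alpha>) \<noteq> bot"
    using compact_cball[of "0::complex" C] nb unfolding compact_filter by blast
  have "(f \<longlongrightarrow> l) \<alpha>"
  proof (rule topological_tendstoI)
    fix S assume S: "open S" "l \<in> S"
    show "\<forall>\<^sub>F x in \<alpha>. f x \<in> S"
    proof (rule ccontr)
      assume "\<not> ?thesis"
      then have "\<forall>\<^sub>F x in \<alpha>. f x \<notin> S"
        using assms(1) unfolding ultrafilter_on_def by (auto dest: spec[of _ "f -` S"])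
      then have "\<forall>\<^sub>F y in filtermap f \<alpha>. y \<notin> S" by (simp add: eventually_filtermap)
      moreover have "\<forall>\<^sub>F y in nhds l. y \<in> S" using S by (auto simp: eventually_nhds)
      ultimately have "eventually (\<lambda>_. False) (inf (nhds l) (filtermap f \<alpha>))"
        unfolding eventually_inf by blast
      then show False using l by (simp add: trivial_limit_def)
    qed
  qed
  then show thesis by (rule that)
qed

lemma ultrafilter_on_UNIV_if_nontrivial: "nontrivial_ultrafilter_on I \<alpha> \<Longrightarrow> ultrafilter_on UNIV \<alpha>"
  by (simp add: nontrivial_ultrafilter_on_def ultrafilter_on_def ultrafilter_on_def)

section \<open>Homomorphisms into ultraproducts and their lifts\<close>

lemma approximate_star_hom_cong:
  assumes ev: "\<forall>\<^sub>F i in \<alpha>. k i = k' i \<and> (\<forall>a. s a i = s' a i)"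
  shows "approximate_star_hom \<alpha> k s \<longleftrightarrow> approximate_star_hom \<alpha> k' s'"
  unfolding approximate_star_hom_def
  by (intro arg_cong2[where f = "(\<and>)"] all_cong1 tendsto_cong; rule eventually_mono[OF ev]; simp)

text \<open>
  Everything but the unit is preserved exactly, and the distance of \<open>\<phi> 1\<close> from the identity is
  determined by its trace.
\<close>

lemma approximate_star_hom_star_reps:
  fixes \<phi> :: "'i \<Rightarrow> 'a::unital_cstar_algebra \<Rightarrow> complex mat"
  assumes ev: "\<forall>\<^sub>F i in \<alpha>. 0 < k i \<and> star_rep (k i) (\<phi> i)"
    and one: "((\<lambda>i. normalized_trace (k i) (\<phi> i 1)) \<longlongrightarrow> 1) \<alpha>"
  shows "approximate_star_hom \<alpha> k (\<lambda>a i. \<phi> i a)"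
proof -
  have z: "((\<lambda>i. mat_2norm (k i) (X i)) \<longlongrightarrow> 0) \<alpha>" if "\<And>i. star_rep (k i) (\<phi> i) \<Longrightarrow> X i = 0\<^sub>m (k i) (k i)" for X
    by (rule tendsto_eventually) (rule eventually_mono[OF ev], simp add: that)
  have u: "((\<lambda>i. mat_2norm (k i) (\<phi> i 1 - 1\<^sub>m (k i))) \<longlongrightarrow> 0) \<alpha>"
  proof (rule Lim_transform_eventually)
    have "((\<lambda>i. sqrt (1 - Re (normalized_trace (k i) (\<phi> i 1)))) \<longlongrightarrow> sqrt (1 - Re 1)) \<alpha>"
      by (intro tendsto_intros one)
    then show "((\<lambda>i. sqrt (1 - Re (normalized_trace (k i) (\<phi> i 1)))) \<longlongrightarrow> 0) \<alpha>" by simp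
    show "\<forall>\<^sub>F i in \<alpha>. sqrt (1 - Re (normalized_trace (k i) (\<phi> i 1))) = mat_2norm (k i) (\<phi> i 1 - 1\<^sub>m (k i))"
    proof (rule eventually_mono[OF ev], elim conjE)
      fix i assume i: "0 < k i" "star_rep (k i) (\<phi> i)"
      note c = star_repD(1)[OF i(2), of 1]
      have "sqrt (1 - Re (normalized_trace (k i) (\<phi> i 1))) = \<bar>mat_2norm (k i) (\<phi> i 1 + (-1) \<cdot>\<^sub>m 1\<^sub>m (k i))\<bar>"
        unfolding star_rep_unit_defect[OF i(2,1), symmetric] by simp
      also have "\<dots> = mat_2norm (k i) (\<phi> i 1 - 1\<^sub>m (k i))"
        unfolding minus_mat_eq[OF c one_carrier_mat] using c by (intro abs_of_nonneg mat_2norm_nonneg) auto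
      finally show "sqrt (1 - Re (normalized_trace (k i) (\<phi> i 1))) = mat_2norm (k i) (\<phi> i 1 - 1\<^sub>m (k i))" .
    qed
  qed
  have mm: "X = Y \<Longrightarrow> X - Y = 0\<^sub>m n n" if "X \<in> carrier_mat n n" for n and X Y :: "complex mat"
    using that by (intro eq_matI) auto
  show ?thesis unfolding approximate_star_hom_def
    by (intro conjI allI; (rule u | rule z, rule mm, erule star_repD(1), simp only: star_repD(2-5)))
qed

context matrix_ultraproduct
begin

lemma star_reps_in_P:
  fixes \<phi> :: "'i \<Rightarrow> 'a::unital_cstar_algebra \<Rightarrow> complex mat"
  assumes "\<And>i. i \<in> I \<Longrightarrow> star_rep (k i) (\<phi> i)"
  shows "(\<lambda>i\<in>I. \<phi> i a) \<in> carrier P"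
  unfolding carrier_P using assms
  by (auto intro!: exI[of _ "norm a"] star_rep_op_bound star_repD(1))

end

text \<open>
  Stability refers to index sets in the type \<open>'i\<close>. Since that type is infinite, an index
  set of natural numbers, its ultrafilter and the family over it can be carried into \<open>'i\<close> along
  an injection, and the lift carried back.
\<close>

lemma stable_lift:
  fixes s :: "'a::unital_cstar_algebra \<Rightarrow> nat \<Rightarrow> complex mat"
  assumes inf: "infinite (UNIV :: 'i set)"
    and stable: "matricially_tracially_stable TYPE('a) TYPE('i)"
    and nt: "nontrivial_ultrafilter_on I \<alpha>"
    and k: "\<And>n. n \<in> I \<Longrightarrow> 0 < k n"
    and s: "\<And>a. s a \<in> carrier (cstar_product I (\<lambda>n. matrix_algebra (k n)))"
    and hom: "approximate_star_hom \<alpha> k s"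
  shows "\<exists>E \<phi>. E \<subseteq> I \<and> (\<forall>\<^sub>F n in \<alpha>. n \<in> E) \<and>
    (\<forall>n\<in>E. star_rep (k n) (\<phi> n) \<and> \<phi> n (1::'a) = 1\<^sub>m (k n)) \<and>
    (\<forall>a. ((\<lambda>n. mat_2norm (k n) (s a n - \<phi> n a)) \<longlongrightarrow> 0) \<alpha>)"
proof -
  obtain g :: "nat \<Rightarrow> 'i" where g: "inj g" using iffD1[OF infinite_iff_countable_subset inf] by metis
  have inv [simp]: "the_inv g (g n) = n" for n using g by (simp add: the_inv_f_f)
  define I' where "I' = g ` I"
  define \<alpha>' where "\<alpha>' = filtermap g \<alpha>"
  define k' where "k' = k \<circ> the_inv g"
  define s' where "s' a = (\<lambda>i\<in>I'. s a (the_inv g i))" for a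
  have evI: "\<forall>\<^sub>F n in \<alpha>. n \<in> I" and nb: "\<alpha> \<noteq> bot"
    using nt by (auto simp: nontrivial_ultrafilter_on_def ultrafilter_on_def)
  have nt': "nontrivial_ultrafilter_on I' \<alpha>'"
    unfolding I'_def \<alpha>'_def by (rule nontrivial_ultrafilter_on_filtermap[OF nt g])
  interpret M: matrix_ultraproduct I \<alpha> k by unfold_locales (use evI nb in auto)
  interpret M': matrix_ultraproduct I' \<alpha>' k'
    by unfold_locales (use nt' in \<open>auto simp: nontrivial_ultrafilter_on_def ultrafilter_on_def\<close>)
  have s'P: "s' a \<in> carrier M'.P" for a
    using s[of a] unfolding M.carrier_P M'.carrier_P s'_def
    by (auto simp: I'_def k'_def)
  have "approximate_star_hom \<alpha> (k' \<circ> g) (\<lambda>a. s' a \<circ> g)"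
    using hom
    by (rule iffD1[OF approximate_star_hom_cong, rotated])
       (rule eventually_mono[OF evI], simp add: k'_def s'_def I'_def)
  then have hom': "approximate_star_hom \<alpha>' k' s'" by (simp add: \<alpha>'_def approximate_star_hom_filtermap)
  then have ush: "unital_star_hom (\<lambda>a. M'.coset (s' a)) M'.U" by (simp add: M'.unital_star_hom_coset_iff[OF s'P])
  have "\<forall>i\<in>I'. 0 < k' i" using k by (auto simp: I'_def k'_def)
  moreover have zero_mat: "\<zero>\<^bsub>matrix_algebra n\<^esub> = 0\<^sub>m n n" for n by (simp add: matrix_algebra_def)
  ultimately have "approximately_liftable I' \<alpha>' (\<lambda>i. matrix_algebra (k' i)) (\<lambda>i. normalized_trace (k' i)) (\<lambda>a. M'.coset (s' a))"
    using stable nt' ush unfolding matricially_tracially_stable_def by blast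
  then obtain E' \<phi>' where E': "E' \<subseteq> I'" "\<forall>\<^sub>F i in \<alpha>'. i \<in> E'"
    and lift: "\<forall>i\<in>E'. unital_star_hom (\<phi>' i) (matrix_algebra (k' i))"
      "\<forall>a. M'.coset (s' a) = M'.coset (\<lambda>i\<in>I'. if i \<in> E' then \<phi>' i a else 0\<^sub>m (k' i) (k' i))"
    unfolding approximately_liftable_def zero_mat by (elim exE conjE)
  note \<phi>' = lift(1)[rule_format] and eq = lift(2)[rule_format]
  have rep: "star_rep (k n) (\<phi>' (g n))" "\<phi>' (g n) 1 = 1\<^sub>m (k n)" if "g n \<in> E'" for n
    using \<phi>'[OF that] by (auto simp: unital_star_hom_matrix_algebra k'_def)
  show ?thesis
  proof (intro exI[of _ "g -` E'"] exI[of _ "\<lambda>n. \<phi>' (g n)"] conjI allI)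
    show "g -` E' \<subseteq> I" using E'(1) g by (auto simp: I'_def inj_def dest!: subsetD)
    show "\<forall>\<^sub>F n in \<alpha>. n \<in> g -` E'" using E'(2) by (simp add: \<alpha>'_def eventually_filtermap)
    then have evE: "\<forall>\<^sub>F n in \<alpha>. g n \<in> E'" by simp
    fix a
    \<comment> \<open>Off \<open>E'\<close> the lift is the zero matrix, hence given by the zero representation.\<close>
    have "(\<lambda>i\<in>I'. (if i \<in> E' then \<phi>' i else (\<lambda>_. 0\<^sub>m (k' i) (k' i))) a) \<in> carrier M'.P"
      by (rule M'.star_reps_in_P)
         (use \<phi>' in \<open>auto simp: unital_star_hom_matrix_algebra star_rep_zero\<close>)
    then have c: "(\<lambda>i\<in>I'. if i \<in> E' then \<phi>' i a else 0\<^sub>m (k' i) (k' i)) \<in> carrier M'.P"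
      by (simp add: if_distrib[of "\<lambda>f. f a"] cong: if_cong)
    have "((\<lambda>n. mat_2norm (k' (g n)) (s' a (g n) - (\<lambda>i\<in>I'. if i \<in> E' then \<phi>' i a else 0\<^sub>m (k' i) (k' i)) (g n))) \<longlongrightarrow> 0) \<alpha>"
      using iffD1[OF M'.coset_eq_iff[OF s'P c] eq[of a]]
      unfolding M'.asymptotic_def unfolding \<alpha>'_def filterlim_filtermap .
    then show "((\<lambda>n. mat_2norm (k n) (s a n - \<phi>' (g n) a)) \<longlongrightarrow> 0) \<alpha>"
      by (rule Lim_transform_eventually)
         (rule eventually_mono[OF eventually_conj[OF evI evE]], simp add: I'_def s'_def k'_def)
  qed (use rep in auto)
qed

section \<open>Pointwise closures and rational convex combinations\<close>

lemma tendsto_pointwise_in_closure: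
  fixes f :: "'i \<Rightarrow> 'a \<Rightarrow> complex"
  assumes nb: "\<alpha> \<noteq> bot" and ev: "\<forall>\<^sub>F i in \<alpha>. f i \<in> S" and lim: "\<And>a. ((\<lambda>i. f i a) \<longlongrightarrow> g a) \<alpha>"
  shows "g \<in> closure S"
proof -
  have "(f \<longlongrightarrow> g) \<alpha>"
    unfolding limitin_canonical_iff[symmetric] euclidean_product_topology[symmetric] limitin_componentwise
    using lim by (auto simp: extensional_def)
  moreover have "\<forall>\<^sub>F i in \<alpha>. f i \<in> closure S"
    by (rule eventually_mono[OF ev]) (use closure_subset in blast)
  ultimately show ?thesis using Lim_in_closed_set[OF closed_closure _ nb] by blast
qed

lemma closure_pointwise_approx:
  fixes g :: "'a \<Rightarrow> complex"
  assumes g: "g \<in> closure S" and F: "finite F" and e: "0 < e"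
  obtains f where "f \<in> S" "\<And>a. a \<in> F \<Longrightarrow> dist (f a) (g a) < e"
proof -
  define W where "W = (\<Inter>a\<in>F. {f. dist (f a) (g a) < e})"
  have "open W" unfolding W_def
    by (intro open_INT F ballI open_Collect_less continuous_intros) auto
  moreover have "g \<in> W" using e by (simp add: W_def)
  ultimately have "W \<inter> S \<noteq> {}" using g open_Int_closure_eq_empty[of W S] by blast
  then show thesis using that by (auto simp: W_def)
qed

lemma closed_tracial_states: "closed {\<tau> :: 'a::unital_cstar_algebra \<Rightarrow> complex. tracial_state \<tau>}"
  unfolding tracial_state_def complex_is_Real_iff
  by (intro closed_Collect_conj closed_Collect_all closed_Collect_eq closed_Collect_le continuous_intros) auto

lemma closed_contractive_functionals:
  "closed {\<tau> :: 'a::unital_cstar_algebra \<Rightarrow> complex. \<forall>a. cmod (\<tau> a) \<le> norm a}"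
  by (intro closed_Collect_all closed_Collect_le continuous_intros) auto

lemma floor_fraction_tendsto: 
  assumes "0 \<le> u"
  shows "(\<lambda>q. real (nat \<lfloor>u * real q\<rfloor>) / real q) \<longlonglongrightarrow> u"
proof -
  have "(\<lambda>q. real (nat \<lfloor>u * real q\<rfloor>) / real q - u) \<longlonglongrightarrow> 0"
  proof (rule Lim_null_comparison[OF _ lim_inverse_n])
    show "\<forall>\<^sub>F q in sequentially. norm (real (nat \<lfloor>u * real q\<rfloor>) / real q - u) \<le> inverse (real q)"
    proof (rule eventually_mono[OF eventually_gt_at_top[of 0]])
      fix q :: nat assume q: "0 < q"
      have "real (nat \<lfloor>u * real q\<rfloor>) = of_int \<lfloor>u * real q\<rfloor>" using assms by simp
      then have "\<bar>real (nat \<lfloor>u * real q\<rfloor>) - u * real q\<bar> \<le> 1" by linarith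
      then have "\<bar>real (nat \<lfloor>u * real q\<rfloor>) - u * real q\<bar> / real q \<le> 1 / real q"
        by (rule divide_right_mono) simp
      moreover have "real (nat \<lfloor>u * real q\<rfloor>) / real q - u = (real (nat \<lfloor>u * real q\<rfloor>) - u * real q) / real q"
        using q by (simp add: field_simps)
      ultimately show "norm (real (nat \<lfloor>u * real q\<rfloor>) / real q - u) \<le> inverse (real q)"
        by (simp add: abs_divide inverse_eq_divide)
    qed
  qed
  then show ?thesis by (simp add: LIM_zero_iff)
qed

text \<open>
  \<open>p n\<^sub>2\<close> copies of a representation on \<open>n\<^sub>1\<close> dimensions beside \<open>(q - p) n\<^sub>1\<close> copies of one on
  \<open>n\<^sub>2\<close> dimensions fill \<open>q n\<^sub>1 n\<^sub>2\<close> dimensions in the ratio \<open>p : q - p\<close>.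
\<close>

lemma matricial_rational_combination:
  fixes \<sigma>1 \<sigma>2 :: "'a::unital_cstar_algebra \<Rightarrow> complex"
  assumes "matricial_tracial_state \<sigma>1" "matricial_tracial_state \<sigma>2" and pq: "p \<le> q" "0 < q"
  shows "matricial_tracial_state (\<lambda>a. of_real (real p / real q) * \<sigma>1 a + of_real (1 - real p / real q) * \<sigma>2 a)"
proof -
  obtain n1 and \<phi>1 :: "'a \<Rightarrow> complex mat" where 1: "0 < n1" "star_rep n1 \<phi>1" "\<phi>1 1 = 1\<^sub>m n1" "\<sigma>1 = normalized_trace n1 \<circ> \<phi>1"
    using assms(1) unfolding matricial_tracial_state_iff by blast
  obtain n2 and \<phi>2 :: "'a \<Rightarrow> complex mat" where 2: "0 < n2" "star_rep n2 \<phi>2" "\<phi>2 1 = 1\<^sub>m n2" "\<sigma>2 = normalized_trace n2 \<circ> \<phi>2"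
    using assms(2) unfolding matricial_tracial_state_iff by blast
  define N where "N = q * n1 * n2"
  have N0: "0 < N" using 1 2 pq by (simp add: N_def)
  obtain A :: "'a \<Rightarrow> complex mat" where A: "star_rep (p * n2 * n1) A" 
    "\<And>a. mat_trace (p * n2 * n1) (A a) = of_nat (p * n2) * mat_trace n1 (\<phi>1 a)"
    using star_rep_multiple[OF 1(2), of "p * n2"] by blast
  obtain B :: "'a \<Rightarrow> complex mat" where B: "star_rep ((q - p) * n1 * n2) B" 
    "\<And>a. mat_trace ((q - p) * n1 * n2) (B a) = of_nat ((q - p) * n1) * mat_trace n2 (\<phi>2 a)"
    using star_rep_multiple[OF 2(2), of "(q - p) * n1"] by blast
  have "p * n2 * n1 + (q - p) * n1 * n2 = (p + (q - p)) * n1 * n2" by (simp only: distrib_left mult_ac)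
  then have dim: "p * n2 * n1 + (q - p) * n1 * n2 = N" using pq by (simp add: N_def)
  obtain \<theta> :: "'a \<Rightarrow> complex mat" where t: "star_rep N \<theta>"
    "\<And>a. mat_trace N (\<theta> a) = of_nat (p * n2) * mat_trace n1 (\<phi>1 a) + of_nat ((q - p) * n1) * mat_trace n2 (\<phi>2 a)"
    using star_rep_sum[OF A(1) B(1)] unfolding dim A(2) B(2) by blast
  have eq: "normalized_trace N (\<theta> a) = of_real (real p / real q) * \<sigma>1 a + of_real (1 - real p / real q) * \<sigma>2 a" for a
  proof -
    have "normalized_trace N (\<theta> a) = (of_nat (p * n2) * mat_trace n1 (\<phi>1 a) + of_nat ((q - p) * n1) * mat_trace n2 (\<phi>2 a)) / of_nat N"
      by (simp add: normalized_trace_eq t(2))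
    also have "\<dots> = of_real (real p / real q) * (mat_trace n1 (\<phi>1 a) / of_nat n1) + of_real (1 - real p / real q) * (mat_trace n2 (\<phi>2 a) / of_nat n2)"
      using pq 1(1) 2(1) by (simp add: N_def of_nat_diff field_simps)
    finally show ?thesis by (simp add: 1(4) 2(4) normalized_trace_eq)
  qed
  \<comment> \<open>The trace already shows that the blocks leave no gap.\<close>
  have "normalized_trace N (\<theta> 1) = 1"
    unfolding eq 1(4) 2(4) by (simp add: 1 2 normalized_trace_one)
  then have "\<theta> 1 = 1\<^sub>m N" using star_rep_unital_if_trace_one[OF t(1) N0] by blast
  then show ?thesis unfolding matricial_tracial_state_iff using N0 t(1) eq by (intro exI[of _ N] exI[of _ \<theta>]) auto
qed

text \<open>
  Rational coefficients approximate real ones for fixed matricial traces, and forming the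
  combination is continuous in the traces, which passes to the closure.
\<close>

lemma convex_closure_matricial:
  "convex (closure {\<tau> :: 'a::unital_cstar_algebra \<Rightarrow> complex. matricial_tracial_state \<tau>})" (is "convex (closure ?M)")
proof (rule convexI)
  fix x y :: "'a \<Rightarrow> complex" and u v :: real
  assume x: "x \<in> closure ?M" and y: "y \<in> closure ?M" and u: "0 \<le> u" and v: "0 \<le> v" and uv: "u + v = 1"
  define h where "h = (\<lambda>(x, y). \<lambda>a::'a. of_real u * x a + of_real v * y a :: complex)"
  have coord: "continuous_on S (\<lambda>p :: ('a \<Rightarrow> complex) \<times> ('a \<Rightarrow> complex). fst p a)"
    "continuous_on S (\<lambda>p :: ('a \<Rightarrow> complex) \<times> ('a \<Rightarrow> complex). snd p a)" for S a
    by (rule continuous_on_product_then_coordinatewise, intro continuous_intros)+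
  have "h ` closure (?M \<times> ?M) \<subseteq> closure ?M"
  proof (rule image_closure_subset)
    show "continuous_on (closure (?M \<times> ?M)) h"
      unfolding h_def case_prod_unfold
      by (intro continuous_on_coordinatewise_then_product continuous_on_add continuous_on_mult
          continuous_on_const coord)
    show "h ` (?M \<times> ?M) \<subseteq> closure ?M"
    proof safe
      fix s t :: "'a \<Rightarrow> complex" assume s: "matricial_tracial_state s" and t: "matricial_tracial_state t"
      define r where "r q = real (nat \<lfloor>u * real q\<rfloor>) / real q" for q
      have r: "r \<longlonglongrightarrow> u" unfolding r_def using floor_fraction_tendsto[OF u] .
      show "h (s, t) \<in> closure ?M"
      proof (rule tendsto_pointwise_in_closure[OF sequentially_bot])
        show "\<forall>\<^sub>F q in sequentially. (\<lambda>a. of_real (r q) * s a + of_real (1 - r q) * t a) \<in> ?M"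
        proof (rule eventually_mono[OF eventually_gt_at_top[of 0]])
          fix q :: nat assume q: "0 < q"
          have "u * real q \<le> real q" using uv v by (intro mult_left_le_one_le) (use u in auto)
          then have "nat \<lfloor>u * real q\<rfloor> \<le> q" by linarith
          then show "(\<lambda>a. of_real (r q) * s a + of_real (1 - r q) * t a) \<in> ?M"
            unfolding r_def using matricial_rational_combination[OF s t _ q] by simp
        qed
        have "v = 1 - u" using uv by linarith
        then have v': "complex_of_real v = 1 - complex_of_real u" by simp
        show "((\<lambda>q. of_real (r q) * s a + of_real (1 - r q) * t a) \<longlongrightarrow> h (s, t) a) sequentially" for a
          unfolding h_def prod.case v' of_real_diff of_real_1 by (intro tendsto_intros r)
      qed
    qed
  qed simp
  then have "h (x, y) \<in> closure ?M" using x y by (auto simp: closure_Times)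
  moreover have "u *\<^sub>R x + v *\<^sub>R y = h (x, y)"
    by (simp add: h_def fun_eq_iff scaleR_fun_def scaleR_conv_of_real)
  ultimately show "u *\<^sub>R x + v *\<^sub>R y \<in> closure ?M" by simp
qed

lemma closure_convex_hull_matricial:
  "closure (convex hull {\<tau> :: 'a::unital_cstar_algebra \<Rightarrow> complex. matricial_tracial_state \<tau>})
    = closure {\<tau>. matricial_tracial_state \<tau>}"
proof (rule antisym)
  show "closure (convex hull {\<tau> :: 'a \<Rightarrow> complex. matricial_tracial_state \<tau>}) \<subseteq> closure {\<tau>. matricial_tracial_state \<tau>}"
    by (intro closure_minimal hull_minimal convex_closure_matricial closure_subset closed_closure)
  show "closure {\<tau> :: 'a \<Rightarrow> complex. matricial_tracial_state \<tau>} \<subseteq> closure (convex hull {\<tau>. matricial_tracial_state \<tau>})"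
    by (intro closure_mono hull_subset)
qed

section \<open>Padding a representation by a zero block\<close>

lemma div_mult_fraction_tendsto:
  assumes m: "0 < m"
  shows "(\<lambda>n. real (n div m * m) / real n) \<longlonglongrightarrow> 1"
proof -
  have "(\<lambda>n. real (n div m * m) / real n - 1) \<longlonglongrightarrow> 0"
  proof (rule Lim_null_comparison)
    show "(\<lambda>n. real m * inverse (real n)) \<longlonglongrightarrow> 0"
      using tendsto_mult_right_zero[OF lim_inverse_n] .
    show "\<forall>\<^sub>F n in sequentially. norm (real (n div m * m) / real n - 1) \<le> real m * inverse (real n)"
    proof (rule eventually_mono[OF eventually_gt_at_top[of 0]])
      fix n :: nat assume n: "0 < n"
      have "real n = real (n div m * m) + real (n mod m)" by (metis div_mult_mod_eq of_nat_add)
      then have "real (n div m * m) / real n - 1 = - (real (n mod m) / real n)"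
        using n by (simp add: field_simps)
      moreover have "real (n mod m) / real n \<le> real m / real n"
        using m by (intro divide_right_mono) auto
      ultimately show "norm (real (n div m * m) / real n - 1) \<le> real m * inverse (real n)"
        by (simp add: inverse_eq_divide)
    qed
  qed
  then show ?thesis by (simp add: LIM_zero_iff)
qed

text \<open>
  The zero block in dimension \<open>n\<close> has size \<open>n mod m\<close>, a vanishing fraction of \<open>n\<close>.
\<close>

lemma padded_representations:
  fixes \<phi> :: "'a::unital_cstar_algebra \<Rightarrow> complex mat"
  assumes rep: "star_rep m \<phi>" and m: "0 < m"
  obtains \<psi> :: "nat \<Rightarrow> 'a \<Rightarrow> complex mat" where "\<And>n. star_rep n (\<psi> n)"
    "\<And>a. (\<lambda>n. normalized_trace n (\<psi> n a)) \<longlonglongrightarrow> normalized_trace m (\<phi> a)"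
proof -
  have "\<forall>n. \<exists>\<psi> :: 'a \<Rightarrow> complex mat. star_rep n \<psi> \<and> (\<forall>a. mat_trace n (\<psi> a) = of_nat (n div m) * mat_trace m (\<phi> a))"
    using star_rep_padded[OF rep] by metis
  then obtain \<psi> :: "nat \<Rightarrow> 'a \<Rightarrow> complex mat" where \<psi>: "\<And>n. star_rep n (\<psi> n)"
    "\<And>n a. mat_trace n (\<psi> n a) = of_nat (n div m) * mat_trace m (\<phi> a)" by metis
  have "(\<lambda>n. normalized_trace n (\<psi> n a)) \<longlonglongrightarrow> normalized_trace m (\<phi> a)" for a
  proof -
    have "normalized_trace n (\<psi> n a) = of_real (real (n div m * m) / real n) * normalized_trace m (\<phi> a)" for n
      using m by (simp add: normalized_trace_eq \<psi>(2))
    moreover have "(\<lambda>n. of_real (real (n div m * m) / real n) * normalized_trace m (\<phi> a)) \<longlonglongrightarrow> of_real 1 * normalized_trace m (\<phi> a)"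
      by (intro tendsto_intros div_mult_fraction_tendsto m)
    ultimately show ?thesis by simp
  qed
  then show thesis using that[of \<psi>] \<psi>(1) by blast
qed

section \<open>Embeddable and matricial traces\<close>

text \<open>
  The lift is asymptotic to representatives of the embedding, so its traces have the same
  limit. That this limit exists, and is then the limit trace, uses that traces of a bounded
  family are bounded.
\<close>

lemma embeddable_tracial_state_limit:
  fixes \<tau> :: "'a::unital_cstar_algebra \<Rightarrow> complex"
  assumes inf: "infinite (UNIV :: 'i set)"
    and stable: "matricially_tracially_stable TYPE('a) TYPE('i)"
    and emb: "embeddable_tracial_state \<tau>"
  obtains \<alpha> :: "nat filter" and \<phi> :: "nat \<Rightarrow> 'a \<Rightarrow> complex mat" where
    "\<alpha> \<noteq> bot" "\<forall>\<^sub>F n in \<alpha>. 0 < n \<and> star_rep n (\<phi> n) \<and> \<phi> n 1 = 1\<^sub>m n"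
    "\<And>a. ((\<lambda>n. normalized_trace n (\<phi> n a)) \<longlongrightarrow> \<tau> a) \<alpha>"
proof -
  obtain \<alpha> and \<pi> :: "'a \<Rightarrow> (nat \<Rightarrow> complex mat) set" where nt: "nontrivial_ultrafilter_on {1..} \<alpha>"
    and hom: "unital_star_hom \<pi> (tracial_ultraproduct {1..} \<alpha> matrix_algebra normalized_trace)"
    and lt: "\<And>a. limit_trace \<alpha> normalized_trace (\<pi> a) = \<tau> a"
    using emb unfolding embeddable_tracial_state_def by blast
  have ultra: "ultrafilter_on UNIV \<alpha>" by (rule ultrafilter_on_UNIV_if_nontrivial[OF nt])
  interpret M: matrix_ultraproduct "{1..}" \<alpha> "\<lambda>n. n"
    by unfold_locales (use nt in \<open>auto simp: nontrivial_ultrafilter_on_def ultrafilter_on_def\<close>)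
  have "\<pi> a \<in> carrier M.U" for a using hom by (simp add: unital_star_hom_def)
  then have "\<forall>a. \<exists>x. x \<in> carrier M.P \<and> \<pi> a = M.coset x" by (auto simp only: M.carrier_U)
  from choice[OF this] obtain s where "\<forall>a. s a \<in> carrier M.P \<and> \<pi> a = M.coset (s a)" ..
  then have s: "\<And>a. s a \<in> carrier M.P" and \<pi>: "\<pi> = (\<lambda>a. M.coset (s a))" by auto
  have ap: "approximate_star_hom \<alpha> (\<lambda>n. n) s"
    using hom unfolding \<pi> by (rule iffD1[OF M.unital_star_hom_coset_iff[OF s]])
  have pos: "n \<in> {1..} \<Longrightarrow> 0 < n" for n :: nat by simp
  from stable_lift[OF inf stable nt pos s ap] obtain E and \<phi> :: "nat \<Rightarrow> 'a \<Rightarrow> complex mat" where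
    E: "E \<subseteq> {1..}" "\<forall>\<^sub>F n in \<alpha>. n \<in> E"
      "\<forall>n\<in>E. star_rep n (\<phi> n) \<and> \<phi> n 1 = 1\<^sub>m n"
      "\<forall>a. ((\<lambda>n. mat_2norm n (s a n - \<phi> n a)) \<longlongrightarrow> 0) \<alpha>"
    by auto
  have "((\<lambda>n. normalized_trace n (\<phi> n a)) \<longlongrightarrow> \<tau> a) \<alpha>" for a
  proof -
    obtain C where C: "0 \<le> C" "\<And>n. n \<in> {1..} \<Longrightarrow> op_bound n (s a n) C" using M.P_bound[OF s] by blast
    have "\<forall>\<^sub>F n in \<alpha>. cmod (normalized_trace n (s a n)) \<le> C"
    proof (rule eventually_mono[OF M.eventually_index])
      fix n :: nat assume n: "n \<in> {1..}"
      note c = M.P_index[OF s n, of a]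
      show "cmod (normalized_trace n (s a n)) \<le> C"
        using normalized_trace_le_2norm[OF c] mat_2norm_le_op_bound[OF c C(2)[OF n] C(1)] by linarith
    qed
    then obtain l where l: "((\<lambda>n. normalized_trace n (s a n)) \<longlongrightarrow> l) \<alpha>"
      by (rule ultrafilter_convergent[OF ultra])
    have "l = \<tau> a" using M.limit_trace_coset[OF s l] lt[of a] unfolding \<pi> by (rule trans[OF sym])
    have ev: "\<forall>\<^sub>F n in \<alpha>. \<phi> n a \<in> carrier_mat n n \<and> s a n \<in> carrier_mat n n"
      by (rule eventually_mono[OF E(2)]) (use E(1,3) star_repD(1) M.P_index[OF s] in \<open>metis subsetD\<close>)
    have "((\<lambda>n. mat_2norm n (\<phi> n a - s a n)) \<longlongrightarrow> 0) \<alpha>"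
      by (rule Lim_transform_eventually[OF E(4)[rule_format, of a]], rule eventually_mono[OF ev])
         (simp add: mat_2norm_minus_commute)
    from tendsto_normalized_trace_2norm_close[OF ev this l] show ?thesis by (simp add: \<open>l = \<tau> a\<close>)
  qed
  moreover have "\<forall>\<^sub>F n in \<alpha>. 0 < n \<and> star_rep n (\<phi> n) \<and> \<phi> n 1 = 1\<^sub>m n"
    by (rule eventually_mono[OF E(2)]) (use E in \<open>auto dest: subsetD\<close>)
  ultimately show thesis using that M.proper by blast
qed

lemma embeddable_in_closure_matricial:
  fixes \<tau> :: "'a::unital_cstar_algebra \<Rightarrow> complex"
  assumes "infinite (UNIV :: 'i set)" "matricially_tracially_stable TYPE('a) TYPE('i)"
    and "embeddable_tracial_state \<tau>"
  shows "\<tau> \<in> closure {\<tau>. matricial_tracial_state \<tau>}"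
proof -
  obtain \<alpha> :: "nat filter" and \<phi> :: "nat \<Rightarrow> 'a \<Rightarrow> complex mat" where
    a: "\<alpha> \<noteq> bot" "\<forall>\<^sub>F n in \<alpha>. 0 < n \<and> star_rep n (\<phi> n) \<and> \<phi> n 1 = 1\<^sub>m n"
    "\<And>a. ((\<lambda>n. normalized_trace n (\<phi> n a)) \<longlongrightarrow> \<tau> a) \<alpha>"
    using embeddable_tracial_state_limit[OF assms] by blast
  have "\<forall>\<^sub>F n in \<alpha>. normalized_trace n \<circ> \<phi> n \<in> {\<tau>. matricial_tracial_state \<tau>}"
    by (rule eventually_mono[OF a(2)]) (auto simp: matricial_tracial_state_iff)
  then show ?thesis by (rule tendsto_pointwise_in_closure[OF a(1)]) (simp add: a(3))
qed

text \<open>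
  The given representation, padded to the missing dimensions, defines a unital homomorphism
  into an ultraproduct over these dimensions. A lift of it is a representation in one of them.
\<close>

lemma finitely_many_missing_dimensions:
  assumes inf: "infinite (UNIV :: 'i set)"
    and stable: "matricially_tracially_stable TYPE('a::unital_cstar_algebra) TYPE('i)"
    and rep: "star_rep m (\<phi> :: 'a \<Rightarrow> complex mat)" "\<phi> 1 = 1\<^sub>m m" and m: "0 < m"
  shows "finite {n. 0 < n \<and> \<not> (\<exists>\<pi> :: 'a \<Rightarrow> complex mat. unital_star_hom \<pi> (matrix_algebra n))}" (is "finite ?B")
proof (rule ccontr)
  assume "infinite ?B"
  then obtain e :: "nat \<Rightarrow> nat" where e: "strict_mono e" "\<And>n. e n \<in> ?B"
    using infinite_enumerate by blast
  obtain \<alpha> :: "nat filter" where \<alpha>: "\<alpha> \<le> sequentially" "ultrafilter_on UNIV \<alpha>"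
    using ultrafilter_below[OF sequentially_bot] by blast
  have nt: "nontrivial_ultrafilter_on UNIV \<alpha>" by (rule nontrivial_ultrafilter_on_UNIV[OF \<alpha>])
  interpret M: matrix_ultraproduct UNIV \<alpha> e
    by unfold_locales (use \<alpha> in \<open>auto simp: ultrafilter_on_def\<close>)
  obtain \<psi> :: "nat \<Rightarrow> 'a \<Rightarrow> complex mat" where \<psi>: "\<And>n. star_rep n (\<psi> n)"
    "\<And>a. (\<lambda>n. normalized_trace n (\<psi> n a)) \<longlonglongrightarrow> normalized_trace m (\<phi> a)"
    using padded_representations[OF rep(1) m] by blast
  define s where "s a n = \<psi> (e n) a" for a n
  have "(\<lambda>n. normalized_trace (e n) (\<psi> (e n) 1)) \<longlonglongrightarrow> 1"
    using filterlim_compose[OF \<psi>(2) filterlim_subseq[OF e(1)], of 1] rep(2) normalized_trace_one[OF m] by simp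
  then have "approximate_star_hom \<alpha> e s"
    unfolding s_def using \<psi>(1) e(2) tendsto_mono[OF \<alpha>(1)] by (intro approximate_star_hom_star_reps) auto
  moreover have "s a \<in> carrier M.P" for a
    using M.star_reps_in_P[of "\<lambda>n. \<psi> (e n)" a] \<psi>(1) unfolding s_def by (simp add: restrict_def)
  moreover have "0 < e n" for n using e(2) by simp
  ultimately have "\<exists>E \<theta>. E \<subseteq> UNIV \<and> (\<forall>\<^sub>F n in \<alpha>. n \<in> E) \<and>
    (\<forall>n\<in>E. star_rep (e n) (\<theta> n) \<and> \<theta> n (1::'a) = 1\<^sub>m (e n)) \<and>
    (\<forall>a. ((\<lambda>n. mat_2norm (e n) (s a n - \<theta> n a)) \<longlongrightarrow> 0) \<alpha>)"
    by (intro stable_lift[OF inf stable nt])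
  then obtain E and \<theta> :: "nat \<Rightarrow> 'a \<Rightarrow> complex mat" where E: "\<forall>\<^sub>F n in \<alpha>. n \<in> E" 
    "\<forall>n\<in>E. star_rep (e n) (\<theta> n) \<and> \<theta> n 1 = 1\<^sub>m (e n)"
    by auto
  obtain n where "n \<in> E" using eventually_happens'[OF M.proper E(1)] by blast
  then have "unital_star_hom (\<theta> n) (matrix_algebra (e n))" using E by (simp add: unital_star_hom_matrix_algebra)
  then show False using e(2)[of n] by blast
qed

text \<open>
  A function \<open>f\<close> that grows slowly enough: the largest \<open>K \<le> n\<close> for which \<open>Q K n\<close> already holds.
\<close>

lemma diagonal_index:
  fixes Q :: "nat \<Rightarrow> nat \<Rightarrow> bool"
  assumes "\<And>K. \<forall>\<^sub>F n in sequentially. Q K n"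
  obtains f where "filterlim f at_top sequentially" "\<forall>\<^sub>F n in sequentially. Q (f n) n"
proof
  define f where "f n = Max {K. K \<le> n \<and> Q K n}" for n
  have fin: "finite {K. K \<le> n \<and> Q K n}" for n by simp
  show "\<forall>\<^sub>F n in sequentially. Q (f n) n"
  proof (rule eventually_mono[OF assms[of 0]])
    fix n assume "Q 0 n"
    then have "f n \<in> {K. K \<le> n \<and> Q K n}" unfolding f_def by (intro Max_in) auto
    then show "Q (f n) n" by simp
  qed
  show "filterlim f at_top sequentially"
    unfolding filterlim_at_top
  proof
    fix K
    show "\<forall>\<^sub>F n in sequentially. K \<le> f n"
      using eventually_conj[OF assms[of K] eventually_ge_at_top[of K]]
      by (rule eventually_mono) (auto simp: f_def intro: Max_ge)
  qed
qed

text \<open>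
  Additive contractive functions are Lipschitz with constant 1, uniformly in \<open>i\<close>.
\<close>

lemma contractive_tendsto_of_dense:
  fixes f :: "'i \<Rightarrow> 'a::real_normed_vector \<Rightarrow> complex"
  assumes f: "\<And>i x y. f i (x + y) = f i x + f i y" "\<And>i x. cmod (f i x) \<le> norm x"
    and g: "\<And>x y. g (x + y) = g x + g y" "\<And>x. cmod (g x) \<le> norm x"
    and D: "closure D = UNIV" and lim: "\<And>d. d \<in> D \<Longrightarrow> ((\<lambda>i. f i d) \<longlongrightarrow> g d) \<alpha>"
  shows "((\<lambda>i. f i a) \<longlongrightarrow> g a) \<alpha>"
proof (rule tendstoI)
  fix e :: real assume e: "0 < e"
  have fd: "dist (f i x) (f i y) \<le> dist x y" for i x y
    using f(1)[of i "x - y" y] f(2)[of i "x - y"] by (simp add: dist_norm)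
  have gd: "dist (g x) (g y) \<le> dist x y" for x y
    using g(1)[of "x - y" y] g(2)[of "x - y"] by (simp add: dist_norm)
  obtain d where d: "d \<in> D" "dist d a < e / 3"
    using D e closure_approachable[of a D] by (metis UNIV_I divide_pos_pos zero_less_numeral)
  show "\<forall>\<^sub>F i in \<alpha>. dist (f i a) (g a) < e"
  proof (rule eventually_mono)
    show "\<forall>\<^sub>F i in \<alpha>. dist (f i d) (g d) < e / 3" using tendstoD[OF lim[OF d(1)], of "e / 3"] e by simp
    fix i assume "dist (f i d) (g d) < e / 3"
    then show "dist (f i a) (g a) < e"
      using fd[of i a d] gd[of d a] d(2) dist_triangle[of "f i a" "g a" "f i d"] dist_triangle[of "f i d" "g a" "g d"]
      by (simp add: dist_commute)
  qed
qed

text \<open>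
  Every \<open>K\<close> gives representations in all large dimensions whose traces are close to \<open>\<tau>\<close> on the
  points \<open>d 0, \<dots>, d K\<close> of a dense sequence: those of a padded matricial trace. A diagonal choice
  makes \<open>K\<close> tend to infinity with the dimension.
\<close>

lemma closure_matricial_embeddable:
  fixes \<tau> :: "'a::unital_cstar_algebra \<Rightarrow> complex"
  assumes sep: "separable_space (euclidean :: 'a topology)"
    and cl: "\<tau> \<in> closure {\<tau>. matricial_tracial_state \<tau>}"
  shows "embeddable_tracial_state \<tau>"
proof -
  have "{\<tau> :: 'a \<Rightarrow> complex. matricial_tracial_state \<tau>} \<subseteq> {\<tau>. tracial_state \<tau>}"
    by (auto simp: matricial_tracial_state_def)
  from closure_minimal[OF this closed_tracial_states] have tr: "tracial_state \<tau>" using cl by auto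
  have contr: "cmod (\<tau> a) \<le> norm a" for a
  proof -
    have "{\<tau> :: 'a \<Rightarrow> complex. matricial_tracial_state \<tau>} \<subseteq> {\<tau>. \<forall>a. cmod (\<tau> a) \<le> norm a}"
      using normalized_trace_star_rep_le by (auto simp: matricial_tracial_state_iff)
    from closure_minimal[OF this closed_contractive_functionals] show ?thesis using cl by auto
  qed
  obtain D :: "'a set" where D: "countable D" "closure D = UNIV"
    using sep unfolding separable_space_def by (auto simp: euclidean_closure_of)
  have "D \<noteq> {}" using D(2) by auto
  define d where "d = from_nat_into D"
  have dD: "D = range d" unfolding d_def using \<open>D \<noteq> {}\<close> D(1) by (simp add: range_from_nat_into)
  define Q where "Q K n \<psi> \<longleftrightarrow> star_rep n \<psi> \<and>
    (\<forall>j\<le>K. dist (normalized_trace n (\<psi> (d j))) (\<tau> (d j)) < inverse (real (Suc K)))" for K n and \<psi> :: "'a \<Rightarrow> complex mat"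
  have evQ: "\<forall>\<^sub>F n in sequentially. \<exists>\<psi>. Q K n \<psi>" for K
  proof -
    define \<epsilon> where "\<epsilon> = inverse (real (Suc K))"
    have e: "0 < \<epsilon>" by (simp add: \<epsilon>_def)
    obtain \<sigma> where \<sigma>: "matricial_tracial_state \<sigma>" "\<And>a. a \<in> d ` {..K} \<Longrightarrow> dist (\<sigma> a) (\<tau> a) < \<epsilon>"
      using closure_pointwise_approx[OF cl, of "d ` {..K}" \<epsilon>] e by auto
    obtain m and \<phi> :: "'a \<Rightarrow> complex mat" where m: "0 < m" "star_rep m \<phi>" "\<sigma> = normalized_trace m \<circ> \<phi>"
      using \<sigma>(1) unfolding matricial_tracial_state_iff by blast
    obtain \<psi> :: "nat \<Rightarrow> 'a \<Rightarrow> complex mat" where \<psi>: "\<And>n. star_rep n (\<psi> n)"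
      "\<And>a. (\<lambda>n. normalized_trace n (\<psi> n a)) \<longlonglongrightarrow> normalized_trace m (\<phi> a)"
      using padded_representations[OF m(2,1)] by blast
    have "\<forall>\<^sub>F n in sequentially. \<forall>j\<in>{..K}. dist (normalized_trace n (\<psi> n (d j))) (\<tau> (d j)) < \<epsilon>"
    proof (rule eventually_ball_finite, simp, rule ballI)
      fix j assume j: "j \<in> {..K}"
      have "((\<lambda>n. dist (normalized_trace n (\<psi> n (d j))) (\<tau> (d j))) \<longlonglongrightarrow> dist (\<sigma> (d j)) (\<tau> (d j)))"
        using \<psi>(2)[of "d j"] m(3) by (intro tendsto_intros) simp
      then show "\<forall>\<^sub>F n in sequentially. dist (normalized_trace n (\<psi> n (d j))) (\<tau> (d j)) < \<epsilon>"
        by (rule order_tendstoD(2)) (use \<sigma>(2) j in auto)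
    qed
    then show ?thesis
      by (rule eventually_mono) (use \<psi>(1) in \<open>auto simp: Q_def \<epsilon>_def intro!: exI[of _ "\<psi> _"]\<close>)
  qed
  obtain f where f: "filterlim f at_top sequentially" "\<forall>\<^sub>F n in sequentially. \<exists>\<psi>. Q (f n) n \<psi>"
    using diagonal_index[of "\<lambda>K n. \<exists>\<psi>. Q K n \<psi>", OF evQ] by blast
  \<comment> \<open>In the finitely many dimensions without a good representation the zero representation is used.\<close>
  have "\<forall>n. \<exists>\<psi>. star_rep n \<psi> \<and> ((\<exists>\<psi>. Q (f n) n \<psi>) \<longrightarrow> Q (f n) n \<psi>)"
  proof
    fix n show "\<exists>\<psi>. star_rep n \<psi> \<and> ((\<exists>\<psi>. Q (f n) n \<psi>) \<longrightarrow> Q (f n) n \<psi>)"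
      using star_rep_zero[of n] by (cases "\<exists>\<psi>. Q (f n) n \<psi>") (auto simp: Q_def)
  qed
  then obtain \<psi> where \<psi>: "\<And>n. star_rep n (\<psi> n)" "\<And>n. \<exists>\<psi>. Q (f n) n \<psi> \<Longrightarrow> Q (f n) n (\<psi> n)" by metis
  have limd: "(\<lambda>n. normalized_trace n (\<psi> n (d j))) \<longlonglongrightarrow> \<tau> (d j)" for j
  proof (rule metric_tendsto_imp_tendsto)
    show "((\<lambda>n. inverse (real (Suc (f n)))) \<longlonglongrightarrow> 0)"
      using filterlim_compose[OF LIMSEQ_inverse_real_of_nat f(1)] .
    have "\<forall>\<^sub>F n in sequentially. j \<le> f n" using f(1) by (simp add: filterlim_at_top)
    then show "\<forall>\<^sub>F n in sequentially. dist (normalized_trace n (\<psi> n (d j))) (\<tau> (d j)) \<le> dist (inverse (real (Suc (f n)))) 0"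
      using f(2) by eventually_elim (use \<psi>(2) in \<open>force simp: Q_def\<close>)
  qed
  have limseq: "(\<lambda>n. normalized_trace n (\<psi> n a)) \<longlonglongrightarrow> \<tau> a" for a
  proof (rule contractive_tendsto_of_dense[where f = "\<lambda>n a. normalized_trace n (\<psi> n a)" and D = D])
    note R = star_repD[OF \<psi>(1)]
    show "normalized_trace n (\<psi> n (x + y)) = normalized_trace n (\<psi> n x) + normalized_trace n (\<psi> n y)" for n x y
      unfolding R(2) by (rule normalized_trace_add[OF R(1) R(1)])
    show "cmod (normalized_trace n (\<psi> n x)) \<le> norm x" for n x
      by (rule normalized_trace_star_rep_le[OF \<psi>(1)])
    show "\<tau> (x + y) = \<tau> x + \<tau> y" for x y using tr by (simp add: tracial_state_def)
  qed (use contr D(2) dD limd in auto)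
  obtain \<beta> :: "nat filter" where \<beta>: "\<beta> \<le> sequentially" "ultrafilter_on UNIV \<beta>"
    using ultrafilter_below[OF sequentially_bot] by blast
  \<comment> \<open>The index set of an embedding is \<open>{1..}\<close>, the range of \<open>Suc\<close>.\<close>
  define \<alpha> where "\<alpha> = filtermap Suc \<beta>"
  have range: "range Suc = {1..}" by (auto simp: image_iff) (metis Suc_pred' less_eq_Suc_le)
  have nt: "nontrivial_ultrafilter_on {1..} \<alpha>"
    unfolding \<alpha>_def range[symmetric]
    by (rule nontrivial_ultrafilter_on_filtermap[OF nontrivial_ultrafilter_on_UNIV[OF \<beta>]]) simp
  have \<alpha>seq: "\<alpha> \<le> sequentially"
    unfolding \<alpha>_def using filtermap_mono[OF \<beta>(1), of Suc] filterlim_Suc by (auto simp: filterlim_def intro: order_trans)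
  interpret M: matrix_ultraproduct "{1..}" \<alpha> "\<lambda>n. n"
    by unfold_locales (use nt in \<open>auto simp: nontrivial_ultrafilter_on_def ultrafilter_on_def\<close>)
  have lim: "((\<lambda>n. normalized_trace n (\<psi> n a)) \<longlongrightarrow> \<tau> a) \<alpha>" for a
    by (rule tendsto_mono[OF \<alpha>seq limseq])
  define s where "s a = (\<lambda>n\<in>{1..}. \<psi> n a)" for a
  have s: "s a \<in> carrier M.P" for a unfolding s_def by (rule M.star_reps_in_P) (rule \<psi>(1))
  have "\<tau> 1 = 1" using tr by (simp add: tracial_state_def)
  then have "approximate_star_hom \<alpha> (\<lambda>n. n) (\<lambda>a n. \<psi> n a)"
    using lim[of 1] M.eventually_index \<psi>(1)
    by (intro approximate_star_hom_star_reps) (auto elim: eventually_mono)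
  then have "approximate_star_hom \<alpha> (\<lambda>n. n) s"
    by (rule iffD1[OF approximate_star_hom_cong, rotated])
       (rule eventually_mono[OF M.eventually_index], simp add: s_def)
  then have "unital_star_hom (\<lambda>a. M.coset (s a)) M.U"
    by (rule iffD2[OF M.unital_star_hom_coset_iff[OF s]])
  moreover have "limit_trace \<alpha> normalized_trace (M.coset (s a)) = \<tau> a" for a
  proof -
    have "((\<lambda>n. normalized_trace n (s a n)) \<longlongrightarrow> \<tau> a) \<alpha>"
      by (rule Lim_transform_eventually[OF lim[of a]])
         (rule eventually_mono[OF M.eventually_index], simp add: s_def)
    then show ?thesis by (rule M.limit_trace_coset[OF s])
  qed
  ultimately show ?thesis
    unfolding embeddable_tracial_state_def using tr nt by blast
qed

theorem theorem3p3:
  assumes "infinite (UNIV :: 'i set)"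
    and "separable_space (euclidean :: 'a::unital_cstar_algebra topology)"
    and "matricially_tracially_stable TYPE('a) TYPE('i)"
    and "\<exists>\<tau> :: 'a \<Rightarrow> complex. embeddable_tracial_state \<tau>"
  shows "finite {n :: nat. 0 < n \<and>
           \<not> (\<exists>\<pi> :: 'a \<Rightarrow> complex mat. unital_star_hom \<pi> (matrix_algebra n))} \<and>
         {\<tau> :: 'a \<Rightarrow> complex. embeddable_tracial_state \<tau>} =
           closure (convex hull {\<tau>. matricial_tracial_state \<tau>})"
proof
  obtain \<tau> :: "'a \<Rightarrow> complex" where "embeddable_tracial_state \<tau>" using assms(4) by blast
  from embeddable_tracial_state_limit[OF assms(1,3) this]
  obtain \<alpha> :: "nat filter" and \<phi> :: "nat \<Rightarrow> 'a \<Rightarrow> complex mat" where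
    \<alpha>: "\<alpha> \<noteq> bot" "\<forall>\<^sub>F n in \<alpha>. 0 < n \<and> star_rep n (\<phi> n) \<and> \<phi> n 1 = 1\<^sub>m n"
    by metis
  obtain m where "0 < m" "star_rep m (\<phi> m)" "\<phi> m 1 = 1\<^sub>m m"
    using eventually_happens'[OF \<alpha>] by blast
  then show "finite {n :: nat. 0 < n \<and>
           \<not> (\<exists>\<pi> :: 'a \<Rightarrow> complex mat. unital_star_hom \<pi> (matrix_algebra n))}"
    by (intro finitely_many_missing_dimensions[OF assms(1,3)])
next
  show "{\<tau> :: 'a \<Rightarrow> complex. embeddable_tracial_state \<tau>} =
           closure (convex hull {\<tau>. matricial_tracial_state \<tau>})"
    unfolding closure_convex_hull_matricial
    using embeddable_in_closure_matricial[OF assms(1,3)] closure_matricial_embeddable[OF assms(2)] by blast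
qed

end
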